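(* There exist an extended affine root system $R$ (reduced) and a character $\Phi:R\to\mathbb C^\times$ for $R$ which cannot be extended to a root-lattice character, i.e. there is no group homomorphism $\bar\Phi:\langle R\rangle\to\mathbb C^\times$ with $\bar\Phi|_R=\Phi$.
   Context: $\langle R\rangle$ denotes the $\mathbb Z$-span of $R$. A map $\psi:R\to\mathbb C^\times$ is a character for $R$ if $\psi(\alpha+\beta)=\psi(\alpha)\psi(\beta)$ whenever $\alpha,\beta,\alpha+\beta\in R$. A root-lattice character for $R$ is a group homomorphism $\langle R\rangle\to\mathbb C^\times$. An extended affine root system is the root system $R$ of an extended affine Lie algebra. An extended affine Lie algebra is a triple $(E,(\cdot,\cdot),\mathcal H)$ where $E$ is a complex Lie algebra, $\mathcal H$ is a non-trivial finite dimensional subalgebra and $(\cdot,\cdot)$ is a symmetric bilinear form on $E$ such that: (A1) the form is invariant and non-degenerate; (A2) $E=\sum_{\alpha\in R}E_\alpha$ with $E_\alpha=\{x\in E\mid [h,x]=\alpha(h)x\ \forall h\in\mathcal H\}$, $R=\{\alpha\in\mathcal H^\star\mid E_\alpha\neq\{0\}\}$ and $E_0=\mathcal H$ ($R$ is the root system); the form restricted to $\mathcal H$ is then non-degenerate, $t_\alpha\in\mathcal H$ is defined by $\alpha(h)=(h,t_\alpha)$, and $(\alpha,\beta):=(t_\alpha,t_\beta)$ on $\mathcal H^\star$; $R^0=\{\alpha\in R\mid(\alpha,\alpha)=0\}$, $R^\times=R\setminus R^0$, and the core $E_c$ is the subalgebra generated by $E_\alpha$, $\alpha\in R^\times$; (A3)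 $\mathrm{ad}(x)$ is locally nilpotent for $x\in E_\alpha$, $\alpha\in R^\times$; (A4) the centralizer of $E_c$ in $E$ is contained in $E_c$; (A5) the $\mathbb Z$-span of $R$ is a free abelian group of finite rank; (A6) if $R^\times=R_1\uplus R_2$ with $R_1,R_2$ non-empty then $R_1\not\perp R_2$. With $\mathcal V=\mathrm{span}_{\mathbb R}R$ and $\mathcal V^0=\mathrm{span}_{\mathbb R}R^0$, the image $\bar R$ of $R$ in $\mathcal V/\mathcal V^0$ is an irreducible finite root system whose type is the type of $R$; reduced means that $\bar R$ is reduced. Known description of type $A_1$: let $\mathcal V=\mathbb R\dot\alpha\oplus\mathcal V^0$, with $\mathcal V^0=\sum_{i=1}^\nu\mathbb R\sigma_i$ of dimension $\nu$, with symmetric bilinear form $(\dot\alpha,\dot\alpha)=2$, $(\mathcal V^0,\mathcal V)=\{0\}$; let $\Lambda=\sum_{i=1}^\nu\mathbb Z\sigma_i$ and let $0=\tau_0,\tau_1,\dots,\tau_m\in\Lambda$ be pairwise distinct modulo $2\Lambda$. With $S=\bigcup_{i=0}^m(\tau_i+2\Lambda)$, the set $R=(S+S)\cup(\pm\dot\alpha+S)$ is an extended affine root system of type $A_1$ with $R^0=S+S$, and every extended affine root system of type $A_1$ can be described in this way. *)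

theory Defs
  imports Complex_Main "HOL-Library.Function_Algebras"
begin

text \<open>
  Complex Lie algebras are carriers \<open>E\<close> that are subspaces of an ambient complex vector space; the
  bracket is a function on the ambient type of which only the values on \<open>E\<close> matter.
\<close>

locale lie_algebra = vector_space scale
  for scale :: "complex \<Rightarrow> 'e::ab_group_add \<Rightarrow> 'e" +
  fixes E :: "'e set"
    and lie :: "'e \<Rightarrow> 'e \<Rightarrow> 'e"
  assumes subspace_carrier: "subspace E"
    and lie_closed: "\<lbrakk>x \<in> E; y \<in> E\<rbrakk> \<Longrightarrow> lie x y \<in> E"
    and lie_add_left: "\<lbrakk>x \<in> E; y \<in> E; z \<in> E\<rbrakk> \<Longrightarrow> lie (x + y) z = lie x z + lie y z"
    and lie_add_right: "\<lbrakk>x \<in> E; y \<in> E; z \<in> E\<rbrakk> \<Longrightarrow> lie x (y + z) = lie x y + lie x z"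
    and lie_scale_left: "\<lbrakk>x \<in> E; y \<in> E\<rbrakk> \<Longrightarrow> lie (scale c x) y = scale c (lie x y)"
    and lie_scale_right: "\<lbrakk>x \<in> E; y \<in> E\<rbrakk> \<Longrightarrow> lie x (scale c y) = scale c (lie x y)"
    and lie_alternating: "x \<in> E \<Longrightarrow> lie x x = 0"
    and jacobi: "\<lbrakk>x \<in> E; y \<in> E; z \<in> E\<rbrakk> \<Longrightarrow>
          lie x (lie y z) + lie y (lie z x) + lie z (lie x y) = 0"
begin

definition subalgebra :: "'e set \<Rightarrow> bool" where
  "subalgebra S \<longleftrightarrow> subspace S \<and> S \<subseteq> E \<and> (\<forall>x\<in>S. \<forall>y\<in>S. lie x y \<in> S)"

definition centralizer :: "'e set \<Rightarrow> 'e set" where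
  "centralizer S = {x \<in> E. \<forall>y\<in>S. lie x y = 0}"

definition locally_nilpotent_ad :: "'e \<Rightarrow> bool" where
  "locally_nilpotent_ad x \<longleftrightarrow> (\<forall>y\<in>E. \<exists>n. (lie x ^^ n) y = 0)"

end

definition int_scale :: "int \<Rightarrow> ('e \<Rightarrow> complex) \<Rightarrow> ('e \<Rightarrow> complex)" where
  "int_scale k \<alpha> = (\<lambda>x. of_int k * \<alpha> x)"

definition real_scale :: "real \<Rightarrow> ('e \<Rightarrow> complex) \<Rightarrow> ('e \<Rightarrow> complex)" where
  "real_scale r \<alpha> = (\<lambda>x. of_real r * \<alpha> x)"

lemma module_int_scale: "module int_scale"
  by unfold_locales (auto simp: int_scale_def fun_eq_iff algebra_simps)

lemma vector_space_real_scale: "vector_space real_scale"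
  by unfold_locales (auto simp: real_scale_def fun_eq_iff algebra_simps)

abbreviation int_span :: "('e \<Rightarrow> complex) set \<Rightarrow> ('e \<Rightarrow> complex) set" where
  "int_span \<equiv> module.span int_scale"

abbreviation real_span :: "('e \<Rightarrow> complex) set \<Rightarrow> ('e \<Rightarrow> complex) set" where
  "real_span \<equiv> module.span real_scale"

definition free_of_finite_rank :: "('e \<Rightarrow> complex) set \<Rightarrow> bool" where
  "free_of_finite_rank G \<longleftrightarrow>
     (\<exists>B. finite B \<and> \<not> module.dependent int_scale B \<and> int_span B = G)"

locale lie_algebra_form_cartan = lie_algebra scale E lie
  for scale :: "complex \<Rightarrow> 'e::ab_group_add \<Rightarrow> 'e" and E lie +
  fixes form :: "'e \<Rightarrow> 'e \<Rightarrow> complex"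
    and H :: "'e set"
  assumes form_sym: "\<lbrakk>x \<in> E; y \<in> E\<rbrakk> \<Longrightarrow> form x y = form y x"
    and form_add_left: "\<lbrakk>x \<in> E; y \<in> E; z \<in> E\<rbrakk> \<Longrightarrow> form (x + y) z = form x z + form y z"
    and form_scale_left: "\<lbrakk>x \<in> E; y \<in> E\<rbrakk> \<Longrightarrow> form (scale c x) y = c * form x y"
    and subalgebra_H: "subalgebra H"
    and H_nontrivial: "H \<noteq> {0}"
    and H_finite_dim: "\<exists>B. finite B \<and> span B = H"
begin

text \<open>
  A functional on \<open>H\<close> is represented by its extension by \<open>0\<close> to the ambient type. This makes the
  representation unique and lets the vector space operations on the dual be the pointwise ones.
\<close>

definition dual_H :: "('e \<Rightarrow> complex) set" where
  "dual_H = {\<alpha>. (\<forall>x\<in>H. \<forall>y\<in>H. \<alpha> (x + y) = \<alpha> x + \<alpha> y) \<and>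
                 (\<forall>c. \<forall>x\<in>H. \<alpha> (scale c x) = c * \<alpha> x) \<and>
                 (\<forall>x. x \<notin> H \<longrightarrow> \<alpha> x = 0)}"

definition root_space :: "('e \<Rightarrow> complex) \<Rightarrow> 'e set" where
  "root_space \<alpha> = {x \<in> E. \<forall>h\<in>H. lie h x = scale (\<alpha> h) x}"

definition roots :: "('e \<Rightarrow> complex) set" where
  "roots = {\<alpha> \<in> dual_H. root_space \<alpha> \<noteq> {0}}"

text \<open>
  Existence and uniqueness of the representing vector follow from (A1) and (A2) below, which make
  the form non-degenerate on the finite-dimensional space \<open>H\<close>.
\<close>

definition dual_vec :: "('e \<Rightarrow> complex) \<Rightarrow> 'e" where
  "dual_vec \<alpha> = (THE t. t \<in> H \<and> (\<forall>h\<in>H. \<alpha> h = form h t))"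

definition dual_form :: "('e \<Rightarrow> complex) \<Rightarrow> ('e \<Rightarrow> complex) \<Rightarrow> complex" where
  "dual_form \<alpha> \<beta> = form (dual_vec \<alpha>) (dual_vec \<beta>)"

definition isotropic_roots :: "('e \<Rightarrow> complex) set" where
  "isotropic_roots = {\<alpha> \<in> roots. dual_form \<alpha> \<alpha> = 0}"

definition nonisotropic_roots :: "('e \<Rightarrow> complex) set" where
  "nonisotropic_roots = roots - isotropic_roots"

definition core :: "'e set" where
  "core = subalgebra hull (\<Union>\<alpha>\<in>nonisotropic_roots. root_space \<alpha>)"

text \<open>
  The class of \<open>\<alpha>\<close> modulo the real span of the isotropic roots. The system of classes of roots
  contains \<open>0\<close>; it is reduced if the only multiples of a non-zero class \<open>a\<close> among the non-zero
  classes are \<open>a\<close> and \<open>-a\<close>.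
\<close>

definition root_class :: "('e \<Rightarrow> complex) \<Rightarrow> ('e \<Rightarrow> complex) set" where
  "root_class \<alpha> = {\<alpha> + \<delta> | \<delta>. \<delta> \<in> real_span isotropic_roots}"

definition reduced :: bool where
  "reduced \<longleftrightarrow>
     (\<forall>\<alpha>\<in>roots. \<forall>\<beta>\<in>roots. \<forall>r::real.
        root_class \<alpha> \<noteq> root_class 0 \<longrightarrow> root_class \<beta> \<noteq> root_class 0 \<longrightarrow>
        root_class \<beta> = root_class (real_scale r \<alpha>) \<longrightarrow> r = 1 \<or> r = -1)"

end

locale extended_affine_lie_algebra = lie_algebra_form_cartan scale E lie form H
  for scale :: "complex \<Rightarrow> 'e::ab_group_add \<Rightarrow> 'e" and E lie form H +
  assumes A1_invariant: "\<lbrakk>x \<in> E; y \<in> E; z \<in> E\<rbrakk> \<Longrightarrow> form (lie x y) z = form x (lie y z)"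
    and A1_nondegenerate: "\<lbrakk>x \<in> E; \<And>y. y \<in> E \<Longrightarrow> form x y = 0\<rbrakk> \<Longrightarrow> x = 0"
    and A2_decomposition: "E = span (\<Union>\<alpha>\<in>roots. root_space \<alpha>)"
    and A2_zero: "root_space 0 = H"
    and A3: "\<lbrakk>\<alpha> \<in> nonisotropic_roots; x \<in> root_space \<alpha>\<rbrakk> \<Longrightarrow> locally_nilpotent_ad x"
    and A4: "centralizer core \<subseteq> core"
    and A5: "free_of_finite_rank (int_span roots)"
    and A6: "\<lbrakk>nonisotropic_roots = R1 \<union> R2; R1 \<inter> R2 = {}; R1 \<noteq> {}; R2 \<noteq> {}\<rbrakk> \<Longrightarrow>
          \<exists>\<alpha>\<in>R1. \<exists>\<beta>\<in>R2. dual_form \<alpha> \<beta> \<noteq> 0"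

definition is_character :: "('e \<Rightarrow> complex) set \<Rightarrow> (('e \<Rightarrow> complex) \<Rightarrow> complex) \<Rightarrow> bool" where
  "is_character R \<psi> \<longleftrightarrow>
     (\<forall>\<alpha>\<in>R. \<psi> \<alpha> \<noteq> 0) \<and>
     (\<forall>\<alpha>\<in>R. \<forall>\<beta>\<in>R. \<alpha> + \<beta> \<in> R \<longrightarrow> \<psi> (\<alpha> + \<beta>) = \<psi> \<alpha> * \<psi> \<beta>)"

definition is_root_lattice_character ::
    "('e \<Rightarrow> complex) set \<Rightarrow> (('e \<Rightarrow> complex) \<Rightarrow> complex) \<Rightarrow> bool" where
  "is_root_lattice_character R \<psi> \<longleftrightarrow>
     (\<forall>\<alpha>\<in>int_span R. \<psi> \<alpha> \<noteq> 0) \<and>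
     (\<forall>\<alpha>\<in>int_span R. \<forall>\<beta>\<in>int_span R. \<psi> (\<alpha> + \<beta>) = \<psi> \<alpha> * \<psi> \<beta>)"

text \<open>
  HOL cannot quantify existentially over types. Lie algebras of countable dimension, up to
  isomorphism, are found among the carriers inside this space of sequences.
\<close>

definition seq_scale :: "complex \<Rightarrow> (nat \<Rightarrow> complex) \<Rightarrow> (nat \<Rightarrow> complex)" where
  "seq_scale c x = (\<lambda>n. c * x n)"

lemma vector_space_seq_scale: "vector_space seq_scale"
  by unfold_locales (auto simp: seq_scale_def fun_eq_iff algebra_simps)

end

theory Submission
  imports Defs "HOL-Analysis.Determinants" "HOL-Library.Poly_Mapping"
begin

text \<open>
  In type \<open>A\<^sub>1\<close> a character can fail to extend. The isotropic roots are \<open>S + S\<close> for a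
  semilattice \<open>S\<close>, a union of cosets of \<open>2\<Lambda>\<close>, and \<open>S + S\<close> need not be a group, so a character is
  only constrained by the relations \<open>\<alpha> + \<beta> = \<gamma>\<close> that hold between roots. The idea is to choose \<open>S\<close>
  with a linear relation that these short relations do not imply.

  Take \<open>\<Lambda> = \<int>\<^sup>6\<close> with its basis \<open>\<sigma>\<^sub>1, \<dots>, \<sigma>\<^sub>6\<close>, put \<open>\<sigma> = \<sigma>\<^sub>1 + \<dots> + \<sigma>\<^sub>6\<close>, and let \<open>S\<close> be the union of
  the cosets of \<open>0, \<sigma>\<^sub>1, \<dots>, \<sigma>\<^sub>6, \<sigma>\<close> modulo \<open>2\<Lambda>\<close>. A vector in \<open>S + S\<close> has 0, 1, 2, 5 or 6 odd
  coordinates. Call it light if it has at most two odd coordinates and heavy if it has at least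
  five, and call a root light or heavy according to its component in \<open>\<Lambda>\<close>. As long as the sum
  stays in \<open>S + S\<close>, light + light is light, because at most four coordinates are odd and 3 and 4 do
  not occur; light + heavy is heavy for the same reason; and heavy + heavy is light, as one sees
  from the even coordinates. So \<open>\<Phi> = 1\<close> on light and \<open>\<Phi> = -1\<close> on heavy roots is a character
  (\<open>gap_char_character\<close>). A homomorphism extending it would be 1 at every \<open>\<sigma>\<^sub>i\<close>, hence 1 at their
  sum \<open>\<sigma>\<close>, but \<open>\<sigma>\<close> is a heavy root (\<open>gap_char_not_extendable\<close>).

  What takes work is an extended affine Lie algebra with this root system. Let \<open>V\<close> be a
  ten-dimensional space with a basis \<open>v\<^sub>p\<close>, where \<open>p\<close> is \<open>Pos\<close>, \<open>Neg\<close>, or one of eight neutral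
  indices, and with the symmetric form that pairs \<open>v\<^sub>p\<close> with \<open>v\<^bsub>bar p\<^esub>\<close>, where \<open>bar\<close> exchanges \<open>Pos\<close>
  and \<open>Neg\<close> and fixes the neutral indices. Give \<open>v\<^sub>p\<close> a weight \<open>1\<close>, \<open>-1\<close> or \<open>0\<close>, and a degree in
  \<open>\<Lambda>\<close>: the eight neutral vectors get the eight representatives of the cosets in \<open>S\<close>, and \<open>Pos\<close> and
  \<open>Neg\<close> get \<open>0\<close>. The matrices over the Laurent polynomials in six variables that are skew for this
  form, and whose \<open>(p, q)\<close> entry has its exponents in \<open>deg p + deg q + 2\<Lambda>\<close>, form a Lie algebra, a
  multiloop algebra of type \<open>so\<^bsub>10\<^esub>\<close>. Being closed under the commutator needs no computation with
  structure constants: skewness and the grading are both compatible with the matrix product. The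
  entries \<open>(Pos, q)\<close> and \<open>(Neg, q)\<close> with \<open>q\<close> neutral carry the roots \<open>\<plusminus>\<alpha> + S\<close>, the entry
  \<open>(Pos, Pos)\<close> and the entries between neutral indices carry \<open>S + S\<close>, and the entries \<open>(Pos, Neg)\<close>
  and \<open>(Neg, Pos)\<close>, which would carry \<open>\<plusminus>2\<alpha> + 2\<Lambda>\<close>, vanish by skewness. The representatives of the cosets are distinct modulo \<open>2\<Lambda>\<close>, so the part of weight 0
  and degree 0 is the line spanned by \<open>h = diag(1, -1, 0, \<dots>, 0)\<close>.

  Adding a six-dimensional centre, through the cocycle built from the trace form, and the six
  degree derivations gives the algebra \<open>E\<close>; the Cartan subalgebra is \<open>\<complex>h\<close> plus the centre plus
  the derivations. Invariance of the form and the Jacobi identity follow from the matrix identities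
  for trace and commutator and from the Leibniz rule. The dual form only sees the coefficient of
  \<open>\<alpha>\<close>, which is \<open>1\<close> or \<open>-1\<close> on every non-isotropic root, so no two of these are orthogonal. Finally,
  an element that centralizes the core is, by invariance, orthogonal to all brackets of core
  elements with \<open>E\<close>, so it has no matrix part; it has no derivation part either, because
  derivations act faithfully on the core (\<open>core_centralizer\<close>). What is left is the centre, and
  brackets of opposite root vectors generate it (\<open>central_in_core\<close>).
\<close>

section \<open>Laurent polynomials in six variables\<close>

type_synonym lattice = "int^6"
type_synonym laurent = "lattice \<Rightarrow>\<^sub>0 complex"

abbreviation coeff :: "('a \<Rightarrow>\<^sub>0 'b::zero) \<Rightarrow> 'a \<Rightarrow> 'b" where
  "coeff \<equiv> Poly_Mapping.lookup"

abbreviation monomial :: "'a \<Rightarrow> 'b::zero \<Rightarrow> 'a \<Rightarrow>\<^sub>0 'b" where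
  "monomial \<equiv> Poly_Mapping.single"

lemma poly_mapping_decompose: "f = (\<Sum>k\<in>Poly_Mapping.keys f. monomial k (coeff f k))"
  by (rule poly_mapping_eqI) (simp add: lookup_sum lookup_single when_def in_keys_iff sum.delta)

lemma poly_mapping_single_induct [case_names zero single add]:
  fixes f :: "'a \<Rightarrow>\<^sub>0 'b::comm_monoid_add"
  assumes "P 0" "\<And>k a. P (monomial k a)" "\<And>f g. P f \<Longrightarrow> P g \<Longrightarrow> P (f + g)"
  shows "P f"
proof -
  have "P (\<Sum>k\<in>A. monomial k (coeff f k))" if "finite A" for A
    using that by (induction A) (auto intro: assms)
  from this[OF finite_keys[of f]] show ?thesis
    by (simp flip: poly_mapping_decompose)
qed

lemma axis_mult: "axis i k $ j * (x::complex) = (if j = i then k * x else 0)"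
  and mult_axis: "x * axis i k $ j = (if j = i then x * k else 0)"
  and mult_axis_int: "x * of_int (axis i n $ j) = (if j = i then x * of_int n else 0)"
  by (simp_all add: axis_def)

text \<open>
  The value of the degree derivation with coefficients \<open>d\<close> on the degree \<open>l\<close>.
\<close>
definition pairing :: "complex^6 \<Rightarrow> lattice \<Rightarrow> complex" where
  "pairing d l = (\<Sum>i\<in>UNIV. d $ i * of_int (l $ i))"

lift_definition laurent_deriv :: "complex^6 \<Rightarrow> laurent \<Rightarrow> laurent" is
  "\<lambda>d f l. pairing d l * f l"
  by (rule finite_subset[rotated]) auto

lemma coeff_laurent_deriv [simp]: "coeff (laurent_deriv d f) l = pairing d l * coeff f l"
  by transfer simp

lemma pairing_simps [simp]:
  "pairing d (l + m) = pairing d l + pairing d m"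
  "pairing (c + d) l = pairing c l + pairing d l"
  "pairing (k *s d) l = k * pairing d l"
  "pairing 0 l = 0"
  "pairing d 0 = 0"
  "pairing d (- l) = - pairing d l"
  "pairing (axis i k) l = k * of_int (l $ i)"
  "pairing d (axis i n) = d $ i * of_int n"
  by (simp_all add: pairing_def distrib_left distrib_right sum.distrib sum_distrib_left sum_negf
      axis_mult mult_axis_int mult.assoc)

lemma laurent_deriv_simps [simp]:
  "laurent_deriv d (f + g) = laurent_deriv d f + laurent_deriv d g"
  "laurent_deriv d (f - g) = laurent_deriv d f - laurent_deriv d g"
  "laurent_deriv d 0 = 0"
  "laurent_deriv d (- f) = - laurent_deriv d f"
  "laurent_deriv (c + d) f = laurent_deriv c f + laurent_deriv d f"
  "laurent_deriv 0 f = 0"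
  "laurent_deriv d (monomial l a) = monomial l (pairing d l * a)"
  "laurent_deriv c (laurent_deriv d f) = laurent_deriv d (laurent_deriv c f)"
  by (auto intro!: poly_mapping_eqI simp: lookup_add lookup_minus lookup_single when_def
    algebra_simps)

lemma laurent_deriv_mult: "laurent_deriv d (f * g) = laurent_deriv d f * g + f * laurent_deriv d g"
proof (induction f rule: poly_mapping_single_induct)
  case (single k a)
  show ?case
    by (induction g rule: poly_mapping_single_induct)
       (auto simp: mult_single algebra_simps simp flip: single_add)
qed (auto simp: algebra_simps)

lemma laurent_deriv_sum: "laurent_deriv d (sum f A) = (\<Sum>x\<in>A. laurent_deriv d (f x))"
  by (induction A rule: infinite_finite_induct) auto

section \<open>Matrices over Laurent polynomials\<close>

text \<open>
  \<open>Pos\<close> and \<open>Neg\<close> span a hyperbolic plane. The other indices stand for the cosets in the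
  semilattice: \<open>Zero\<close> for \<open>2\<Lambda>\<close>, \<open>Gen i\<close> for the \<open>i\<close>-th basis vector, and \<open>Total\<close> for the sum of
  the basis vectors.
\<close>
datatype ix = Pos | Neg | Zero | Gen 6 | Total

lemma UNIV_ix: "(UNIV :: ix set) = {Pos, Neg, Zero, Total} \<union> range Gen"
proof -
  have "x \<in> {Pos, Neg, Zero, Total} \<union> range Gen" for x by (cases x) auto
  then show ?thesis by blast
qed

instance ix :: finite
  by standard (simp add: UNIV_ix)

type_synonym mat = "laurent^ix^ix"

lemma matrix_ring_simps:
  fixes A B C :: mat
  shows "(A + B) ** C = A ** C + B ** C" "C ** (A + B) = C ** A + C ** B"
    "(A - B) ** C = A ** C - B ** C" "C ** (A - B) = C ** A - C ** B"
    "(- A) ** C = - (A ** C)" "C ** (- A) = - (C ** A)" "0 ** C = 0" "C ** 0 = 0"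
  by (simp_all add: matrix_matrix_mult_def vec_eq_iff algebra_simps sum.distrib sum_subtractf
    sum_negf)

definition mat_scale :: "complex \<Rightarrow> mat \<Rightarrow> mat" where
  "mat_scale k X = (\<chi> p q. monomial 0 k * X $ p $ q)"

lemma coeff_monomial_zero_mult [simp]:
  "coeff (monomial 0 k * f) l = k * coeff (f :: laurent) l"
  by (simp flip: mult_map_scale_conv_mult add: Poly_Mapping.map.rep_eq when_def)

lemma mat_scale_mult: "mat_scale k X ** Y = mat_scale k (X ** Y)"
  "X ** mat_scale k Y = mat_scale k (X ** Y)"
  by (simp_all add: mat_scale_def matrix_matrix_mult_def vec_eq_iff sum_distrib_left algebra_simps)

lemma mat_scale_simps [simp]:
  "mat_scale k (X + Y) = mat_scale k X + mat_scale k Y"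
    "mat_scale k (X - Y) = mat_scale k X - mat_scale k Y"
  "mat_scale (j + k) X = mat_scale j X + mat_scale k X"
    "mat_scale j (mat_scale k X) = mat_scale (j * k) X" "mat_scale 1 X = X"
  "mat_scale k 0 = 0"  "mat_scale 0 X = 0"
  by (auto simp: mat_scale_def vec_eq_iff lookup_add lookup_minus distrib_left distrib_right
    right_diff_distrib
      mult.assoc intro!: poly_mapping_eqI)

definition degree_deriv :: "complex^6 \<Rightarrow> mat \<Rightarrow> mat" where
  "degree_deriv d X = (\<chi> p q. laurent_deriv d (X $ p $ q))"

lemma degree_deriv_nth [simp]: "degree_deriv d X $ p $ q = laurent_deriv d (X $ p $ q)"
  by (simp add: degree_deriv_def)

lemma mat_scale_nth [simp]: "mat_scale k X $ p $ q = monomial 0 k * X $ p $ q"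
  by (simp add: mat_scale_def)

lemma degree_deriv_simps [simp]:
  "degree_deriv d (X + Y) = degree_deriv d X + degree_deriv d Y"
    "degree_deriv d (X - Y) = degree_deriv d X - degree_deriv d Y"
      "degree_deriv (c + d) X = degree_deriv c X + degree_deriv d X"
  "degree_deriv d (mat_scale k X) = mat_scale k (degree_deriv d X)"
    "degree_deriv (k *s d) X = mat_scale k (degree_deriv d X)" "degree_deriv 0 X = 0"
      "degree_deriv d 0 = 0"
  "degree_deriv d (- X) = - degree_deriv d X"
  by (auto simp: vec_eq_iff laurent_deriv_mult) (auto intro!: poly_mapping_eqI)

lemma degree_deriv_commute: "degree_deriv c (degree_deriv d X) = degree_deriv d (degree_deriv c X)"
  by (simp add: vec_eq_iff)

lemma degree_deriv_mult: "degree_deriv d (X ** Y) = degree_deriv d X ** Y + X ** degree_deriv d Y"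
  by (simp add: vec_eq_iff matrix_matrix_mult_def laurent_deriv_sum laurent_deriv_mult sum.distrib)

definition commutator :: "mat \<Rightarrow> mat \<Rightarrow> mat" where
  "commutator X Y = X ** Y - Y ** X"

definition trace_form :: "mat \<Rightarrow> mat \<Rightarrow> complex" where
  "trace_form X Y = coeff (trace (X ** Y)) 0"

lemma trace_mat_scale [simp]: "trace (mat_scale k X) = monomial 0 k * trace X"
  by (simp add: trace_def sum_distrib_left)

lemma trace_minus [simp]: "trace (- X :: mat) = - trace X"
  by (simp add: trace_def sum_negf)

lemma trace_form_sym: "trace_form X Y = trace_form Y X"
  unfolding trace_form_def by (subst trace_mul_sym) simp

lemma trace_form_simps [simp]:
  "trace_form (X + Y) Z = trace_form X Z + trace_form Y Z"
    "trace_form Z (X + Y) = trace_form Z X + trace_form Z Y"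
  "trace_form (X - Y) Z = trace_form X Z - trace_form Y Z"
    "trace_form Z (X - Y) = trace_form Z X - trace_form Z Y"
  "trace_form (mat_scale k X) Z = k * trace_form X Z"
    "trace_form Z (mat_scale k X) = k * trace_form Z X"
  "trace_form (- X) Z = - trace_form X Z" "trace_form Z (- X) = - trace_form Z X"
  "trace_form 0 Z = 0" "trace_form Z 0 = 0"
  by (simp_all add: trace_form_def matrix_ring_simps trace_add trace_sub mat_scale_mult lookup_add
    lookup_minus)
     (simp_all add: trace_def)

text \<open>
  Invariance is the cyclicity of the trace.
\<close>
lemma trace_form_commutator: "trace_form (commutator X Y) Z = trace_form X (commutator Y Z)"
proof -
  have "trace_form ((Y ** X)) Z = trace_form X (Z ** Y)"
    unfolding trace_form_def
    by (metis matrix_mul_assoc trace_mul_sym)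
  then show ?thesis
    by (simp add: commutator_def) (simp add: trace_form_def matrix_mul_assoc)
qed

lemma coeff_trace_degree_deriv: "coeff (trace (degree_deriv d X)) 0 = 0"
  by (simp add: trace_def lookup_sum)

text \<open>
  A derivative has no coefficient in degree 0, so the Leibniz rule for \<open>X ** Y\<close> makes the degree
  derivations skew for the trace form.
\<close>
lemma trace_form_degree_deriv: "trace_form (degree_deriv d X) Y = - trace_form X (degree_deriv d Y)"
  using coeff_trace_degree_deriv[of d "X ** Y"]
  by (simp add: trace_form_def degree_deriv_mult trace_add lookup_add add_eq_0_iff)

lemma commutator_simps [simp]:
  "commutator (X + Y) Z = commutator X Z + commutator Y Z"
    "commutator Z (X + Y) = commutator Z X + commutator Z Y"
  "commutator (X - Y) Z = commutator X Z - commutator Y Z"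
    "commutator Z (X - Y) = commutator Z X - commutator Z Y"
  "commutator (mat_scale k X) Z = mat_scale k (commutator X Z)"
    "commutator Z (mat_scale k X) = mat_scale k (commutator Z X)"
  "commutator 0 Z = 0" "commutator Z 0 = 0" "commutator X X = 0"
  by (simp_all add: commutator_def matrix_ring_simps mat_scale_mult)

lemma commutator_antisym: "commutator X Y = - commutator Y X"
  by (simp add: commutator_def)

lemma commutator_jacobi:
  "commutator X (commutator Y Z) + commutator Y (commutator Z X) + commutator Z (commutator X Y)
    = 0"
  by (simp add: commutator_def matrix_ring_simps matrix_mul_assoc)

lemma degree_deriv_commutator: "degree_deriv d (commutator X Y)
  = commutator (degree_deriv d X) Y + commutator X (degree_deriv d Y)"
  by (simp add: commutator_def degree_deriv_mult)

section \<open>Central extension and degree derivations\<close>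

definition dot :: "complex^6 \<Rightarrow> complex^6 \<Rightarrow> complex" where
  "dot c d = (\<Sum>i\<in>UNIV. c $ i * d $ i)"

lemma dot_simps [simp]:
  "dot (a + b) c = dot a c + dot b c" "dot c (a + b) = dot c a + dot c b"
  "dot (k *s a) c = k * dot a c" "dot c (k *s a) = k * dot c a"
  "dot 0 c = 0" "dot c 0 = 0"
  "dot c (axis i k) = c $ i * k"
  by (auto simp: dot_def sum.distrib sum_distrib_left algebra_simps mult_axis)

lemma dot_sym: "dot c d = dot d c"
  by (simp add: dot_def mult.commute)

text \<open>
  Kac's cocycle for affine algebras, with one component for each of the six variables.
\<close>
definition cocycle :: "mat \<Rightarrow> mat \<Rightarrow> complex^6" where
  "cocycle X Y = (\<chi> i. trace_form (degree_deriv (axis i 1) X) Y)"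

lemma cocycle_simps [simp]:
  "cocycle (X + Y) Z = cocycle X Z + cocycle Y Z" "cocycle Z (X + Y) = cocycle Z X + cocycle Z Y"
  "cocycle (X - Y) Z = cocycle X Z - cocycle Y Z" "cocycle Z (X - Y) = cocycle Z X - cocycle Z Y"
  "cocycle (mat_scale k X) Z = k *s cocycle X Z" "cocycle Z (mat_scale k X) = k *s cocycle Z X"
  "cocycle 0 Z = 0" "cocycle Z 0 = 0"
  by (simp_all add: cocycle_def vec_eq_iff)

lemma cocycle_antisym: "cocycle X Y = - cocycle Y X"
  by (simp add: cocycle_def vec_eq_iff) (metis trace_form_degree_deriv trace_form_sym)

lemma cocycle_self [simp]: "cocycle X X = 0"
proof -
  have "trace_form (degree_deriv d X) X = 0" for d
    using trace_form_degree_deriv[of d X X] trace_form_sym[of X "degree_deriv d X"] by simp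
  then show ?thesis by (simp add: cocycle_def vec_eq_iff)
qed

lemma degree_deriv_decompose: "degree_deriv d X
  = (\<Sum>i\<in>UNIV. mat_scale (d $ i) (degree_deriv (axis i 1) X))"
  by (auto simp: vec_eq_iff lookup_sum pairing_def[of d] sum_distrib_right mult.assoc intro!:
    poly_mapping_eqI sum.cong)

lemma trace_form_sum_left: "trace_form (sum f A) Y = (\<Sum>x\<in>A. trace_form (f x) Y)"
  by (induction A rule: infinite_finite_induct) auto

lemma dot_cocycle: "dot d (cocycle X Y) = trace_form (degree_deriv d X) Y"
  by (simp add: degree_deriv_decompose[of d] trace_form_sum_left dot_def cocycle_def)

text \<open>
  Moving the derivation to the other factor by skewness, the Leibniz rule splits the first summand
  into two terms, and cyclicity of the trace identifies them with the other two summands.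
\<close>
lemma cocycle_commutator:
  "cocycle X (commutator Y Z) + cocycle Y (commutator Z X) + cocycle Z (commutator X Y) = 0"
proof -
  have "trace_form (degree_deriv d X) (commutator Y Z)
    + trace_form (degree_deriv d Y) (commutator Z X) + trace_form (degree_deriv d Z)
      (commutator X Y) = 0" for d
  proof -
    have "trace_form (degree_deriv d X) (commutator Y Z)
      = - trace_form X (commutator (degree_deriv d Y) Z) - trace_form X (commutator Y
        (degree_deriv d Z))"
      by (simp add: trace_form_degree_deriv degree_deriv_commutator)
    moreover have "trace_form X (commutator (degree_deriv d Y) Z)
      = trace_form (degree_deriv d Y) (commutator Z X)"
      using trace_form_commutator trace_form_sym by metis
    moreover have "trace_form X (commutator Y (degree_deriv d Z))
      = trace_form (degree_deriv d Z) (commutator X Y)"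
      using trace_form_commutator trace_form_sym by metis
    ultimately show ?thesis by simp
  qed
  then show ?thesis by (simp add: cocycle_def vec_eq_iff)
qed

lemma cocycle_degree_deriv: "cocycle X (degree_deriv d Y) = cocycle Y (degree_deriv d X)"
  by (simp add: cocycle_def vec_eq_iff)
    (metis trace_form_degree_deriv trace_form_sym degree_deriv_commute minus_minus)

text \<open>
  A triple \<open>(X, c, d)\<close> stands for the matrix \<open>X\<close>, the central element \<open>c\<close> and the degree derivation
  \<open>d\<close>. The form pairs the centre with the derivations, and then its invariance forces the cocycle as
  the central part of the bracket.
\<close>
type_synonym ext_elem = "mat \<times> (complex^6) \<times> (complex^6)"

fun ext_scale :: "complex \<Rightarrow> ext_elem \<Rightarrow> ext_elem" where
  "ext_scale k (X, c, d) = (mat_scale k X, k *s c, k *s d)"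

fun ext_lie :: "ext_elem \<Rightarrow> ext_elem \<Rightarrow> ext_elem" where
  "ext_lie (X, c, d) (Y, c', d')
    = (commutator X Y + degree_deriv d Y - degree_deriv d' X, cocycle X Y, 0)"

fun ext_form :: "ext_elem \<Rightarrow> ext_elem \<Rightarrow> complex" where
  "ext_form (X, c, d) (Y, c', d') = trace_form X Y + dot c d' + dot d c'"

lemma vector_space_ext_scale: "vector_space ext_scale"
  by unfold_locales (auto simp: zero_prod_def vec.scale_right_distrib vec.scale_left_distrib)

lemma ext_lie_jacobi: "ext_lie u (ext_lie v w) + ext_lie v (ext_lie w u) + ext_lie w (ext_lie u v)
  = 0"
proof -
  obtain X c d Y c' d' Z c'' d'' where [simp]: "u = (X, c, d)" "v = (Y, c', d')" "w = (Z, c'', d'')"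
    by (metis prod_cases3)
  have "commutator Z (degree_deriv d Y) = - commutator (degree_deriv d Y) Z"
    "commutator X (degree_deriv d' Z) = - commutator (degree_deriv d' Z) X"
      "commutator Y (degree_deriv d'' X) = - commutator (degree_deriv d'' X) Y"
    by (rule commutator_antisym)+
  then show ?thesis
    using commutator_jacobi[of X Y Z] cocycle_commutator[of X Y Z]
      cocycle_degree_deriv[of X d' Z] cocycle_degree_deriv[of Y d'' X] cocycle_degree_deriv[of Z d
        Y]
      degree_deriv_commute[of d d' Z] degree_deriv_commute[of d d'' Y] degree_deriv_commute[of d'
        d'' X]
    by (simp add: zero_prod_def degree_deriv_commutator algebra_simps)
qed

lemma ext_form_invariant: "ext_form (ext_lie u v) w = ext_form u (ext_lie v w)"
proof -
  obtain X c d Y c' d' Z c'' d'' where [simp]: "u = (X, c, d)" "v = (Y, c', d')" "w = (Z, c'', d'')"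
    by (metis prod_cases3)
  have "dot (cocycle X Y) d'' = trace_form (degree_deriv d'' X) Y"
    "dot d (cocycle Y Z) = trace_form (degree_deriv d Y) Z"
    by (simp_all add: dot_cocycle dot_sym[of "cocycle X Y"])
  then show ?thesis
    by (simp add: trace_form_commutator trace_form_degree_deriv)
qed

section \<open>The multiloop algebra of skew graded matrices\<close>

fun bar :: "ix \<Rightarrow> ix" where
  "bar Pos = Neg" | "bar Neg = Pos" | "bar p = p"

fun wt :: "ix \<Rightarrow> int" where
  "wt Pos = 1" | "wt Neg = -1" | "wt p = 0"

fun deg :: "ix \<Rightarrow> lattice" where
  "deg (Gen i) = axis i 1" | "deg Total = 1" | "deg p = 0"

definition odds :: "lattice \<Rightarrow> 6 set" where
  "odds l = {i. odd (l $ i)}"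

lemma odds_add: "odds (l + m) = sym_diff (odds l) (odds m)"
  by (auto simp: odds_def)

lemma odds_simps: "odds 0 = {}" "odds (axis i 1) = {i}" "odds 1 = UNIV"
  by (auto simp: odds_def axis_def)

lemma bar_bar [simp]: "bar (bar p) = p"
  by (cases p) auto

lemma bar_eq_iff [simp]: "bar p = bar q \<longleftrightarrow> p = q"
  by (metis bar_bar)

lemma bij_bar: "bij bar"
  by (rule involuntory_imp_bij) simp

lemma wt_bar [simp]: "wt (bar p) = - wt p"
  by (cases p) auto

lemma deg_bar [simp]: "deg (bar p) = deg p"
  by (cases p) auto

text \<open>
  \<open>l\<close> lies in \<open>deg p + deg q + 2\<Lambda>\<close>; signs do not matter modulo \<open>2\<Lambda>\<close>.
\<close>
definition in_coset :: "ix \<Rightarrow> ix \<Rightarrow> lattice \<Rightarrow> bool" where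
  "in_coset p q l \<longleftrightarrow> (\<forall>i. even (l $ i - deg p $ i - deg q $ i))"

lemma in_coset_bar [simp]: "in_coset (bar p) q l = in_coset p q l"
  "in_coset p (bar q) l = in_coset p q l"
  by (simp_all add: in_coset_def)

lemma in_coset_sym: "in_coset p q l = in_coset q p l"
  by (simp add: in_coset_def algebra_simps)

lemma in_coset_add:
  assumes "in_coset p k l" "in_coset k q m"
  shows "in_coset p q (l + m)"
  unfolding in_coset_def
proof
  fix i
  show "even ((l + m) $ i - deg p $ i - deg q $ i)"
    using assms[unfolded in_coset_def, THEN spec, of i] by auto
qed

lemma odds_in_coset: "in_coset p q l \<Longrightarrow> odds l = sym_diff (odds (deg p)) (odds (deg q))"
  by (auto simp: odds_def in_coset_def)

text \<open>
  For indices of equal weight the degrees are distinct modulo \<open>2\<Lambda>\<close>. This keeps the zero root space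
  from being larger than the Cartan subalgebra.
\<close>
lemma deg_distinct:
  assumes "in_coset p q 0" "wt p = wt q"
  shows "p = q"
proof -
  have "odds (deg p) = odds (deg q)"
    using odds_in_coset[OF assms(1)] unfolding odds_simps(1) by blast
  moreover have "UNIV \<noteq> {i}" for i :: 6
  proof
    assume "UNIV = {i}"
    then have "card (UNIV :: 6 set) = card {i}" by (rule arg_cong)
    then show False by simp
  qed
  ultimately show ?thesis
    using assms(2) by (cases p; cases q) (auto simp: odds_simps)
qed

text \<open>
  The adjoint for the bilinear form on \<open>V\<close> that pairs \<open>v\<^sub>p\<close> with \<open>v\<^bsub>bar p\<^esub>\<close>: the transpose, conjugated
  by the permutation \<open>bar\<close>.
\<close>
definition mat_adjoint :: "mat \<Rightarrow> mat" where
  "mat_adjoint X = (\<chi> p q. X $ bar q $ bar p)"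

lemma mat_adjoint_nth [simp]: "mat_adjoint X $ p $ q = X $ bar q $ bar p"
  by (simp add: mat_adjoint_def)

lemma mat_adjoint_mult: "mat_adjoint (X ** Y) = mat_adjoint Y ** mat_adjoint X"
proof -
  have "(\<Sum>k\<in>UNIV. X $ p $ k * Y $ k $ q) = (\<Sum>k\<in>UNIV. Y $ bar k $ q * X $ p $ bar k)" for p q
    by (subst sum.reindex_bij_betw[OF bij_bar, symmetric]) (simp add: mult.commute)
  then show ?thesis
    by (simp add: vec_eq_iff matrix_matrix_mult_def)
qed

definition graded :: "mat \<Rightarrow> bool" where
  "graded X \<longleftrightarrow> (\<forall>p q l. coeff (X $ p $ q) l \<noteq> 0 \<longrightarrow> in_coset p q l)"

definition skew_graded :: "mat set" where
  "skew_graded = {X. mat_adjoint X = - X \<and> graded X}"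

lemma coeff_mult_nonzeroE:
  assumes "coeff (f * g :: laurent) l \<noteq> 0"
  obtains a b where "l = a + b" "coeff f a \<noteq> 0" "coeff g b \<noteq> 0"
  using assms Poly_Mapping.keys_mult[of f g] by (fastforce simp: in_keys_iff)

lemma graded_mult: "graded X \<Longrightarrow> graded Y \<Longrightarrow> graded (X ** Y)"
  unfolding graded_def
proof (intro allI impI)
  fix p q l assume X: "\<forall>p q l. coeff (X $ p $ q) l \<noteq> 0 \<longrightarrow> in_coset p q l"
    and Y: "\<forall>p q l. coeff (Y $ p $ q) l \<noteq> 0 \<longrightarrow> in_coset p q l"
    and "coeff ((X ** Y) $ p $ q) l \<noteq> 0"
  then have "(\<Sum>k\<in>UNIV. coeff (X $ p $ k * Y $ k $ q) l) \<noteq> 0"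
    by (simp add: matrix_matrix_mult_def lookup_sum)
  then obtain k where "coeff (X $ p $ k * Y $ k $ q) l \<noteq> 0"
    by (meson sum.neutral)
  then show "in_coset p q l"
    using X Y by (elim coeff_mult_nonzeroE) (metis in_coset_add)
qed

lemma graded_simps:
  "graded 0" "graded X \<Longrightarrow> graded Y \<Longrightarrow> graded (X + Y)" "graded X \<Longrightarrow> graded Y \<Longrightarrow> graded (X - Y)"
  "graded X \<Longrightarrow> graded (mat_scale k X)" "graded X \<Longrightarrow> graded (degree_deriv d X)"
  by (auto simp: graded_def lookup_add lookup_minus) (metis add_0 diff_0_right)+

lemma mat_adjoint_simps:
  "mat_adjoint 0 = 0" "mat_adjoint (X + Y) = mat_adjoint X + mat_adjoint Y"
    "mat_adjoint (X - Y) = mat_adjoint X - mat_adjoint Y"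
  "mat_adjoint (mat_scale k X) = mat_scale k (mat_adjoint X)"
    "mat_adjoint (degree_deriv d X) = degree_deriv d (mat_adjoint X)"
  by (simp_all add: vec_eq_iff)

lemma mat_scale_minus [simp]: "mat_scale k (- X) = - mat_scale k X"
  by (simp add: vec_eq_iff)

lemma skew_graded_simps:
  "0 \<in> skew_graded" "X \<in> skew_graded \<Longrightarrow> Y \<in> skew_graded \<Longrightarrow> X + Y \<in> skew_graded"
    "X \<in> skew_graded \<Longrightarrow> Y \<in> skew_graded \<Longrightarrow> X - Y \<in> skew_graded"
  "X \<in> skew_graded \<Longrightarrow> mat_scale k X \<in> skew_graded" "X \<in> skew_graded \<Longrightarrow> degree_deriv d X \<in> skew_graded"
  by (auto simp: skew_graded_def mat_adjoint_simps graded_simps)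

lemma skew_graded_commutator: "X \<in> skew_graded \<Longrightarrow> Y \<in> skew_graded \<Longrightarrow> commutator X Y \<in> skew_graded"
  by (auto simp: skew_graded_def mat_adjoint_simps graded_simps graded_mult commutator_def
    mat_adjoint_mult matrix_ring_simps)

definition mat_unit :: "ix \<Rightarrow> ix \<Rightarrow> lattice \<Rightarrow> mat" where
  "mat_unit p q l = (\<chi> r s. if r = p \<and> s = q then monomial l 1 else 0)"

text \<open>
  The basic skew matrix, which corresponds to \<open>v\<^sub>p \<and> v\<^bsub>bar q\<^esub>\<close> times a monomial. It vanishes exactly
  when \<open>q = bar p\<close>.
\<close>
definition skew_unit :: "ix \<Rightarrow> ix \<Rightarrow> lattice \<Rightarrow> mat" where
  "skew_unit p q l = mat_unit p q l - mat_unit (bar q) (bar p) l"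

lemma mat_unit_nth: "mat_unit p q l $ r $ s = (if r = p \<and> s = q then monomial l 1 else 0)"
  by (simp add: mat_unit_def)

lemma mat_unit_mult: "mat_unit p q l ** mat_unit r s m
  = (if q = r then mat_unit p s (l + m) else 0)"
proof -
  have "(\<Sum>k\<in>UNIV. mat_unit p q l $ a $ k * mat_unit r s m $ k $ b)
    = (\<Sum>k\<in>UNIV. if k = q then mat_unit p q l $ a $ q * mat_unit r s m $ q $ b else 0)" for a b
    by (rule sum.cong) (simp_all add: mat_unit_nth)
  then have "(mat_unit p q l ** mat_unit r s m) $ a $ b
    = mat_unit p q l $ a $ q * mat_unit r s m $ q $ b" for a b
    by (simp add: matrix_matrix_mult_def)
  then show ?thesis
    by (simp add: vec_eq_iff mat_unit_nth mult_single)
qed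

lemma coeff_skew_unit:
  "coeff (skew_unit p q l $ r $ s) m
    = of_bool (r = p \<and> s = q \<and> m = l) - of_bool (r = bar q \<and> s = bar p \<and> m = l)"
proof -
  have "coeff (mat_unit p q l $ r $ s) m = of_bool (r = p \<and> s = q \<and> m = l)" for p q r s l
    by (auto simp: mat_unit_nth lookup_single when_def)
  then show ?thesis
    by (simp add: skew_unit_def lookup_minus)
qed

lemma coeff_skew_unit_nonzeroD:
  assumes "coeff (skew_unit p q l $ r $ s) m \<noteq> 0"
  shows "(r = p \<and> s = q \<or> r = bar q \<and> s = bar p) \<and> m = l"
proof (rule ccontr)
  assume "\<not> ?thesis"
  then have "\<not> (r = p \<and> s = q \<and> m = l)" "\<not> (r = bar q \<and> s = bar p \<and> m = l)"
    by argo+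
  then have "coeff (skew_unit p q l $ r $ s) m = 0"
    by (simp only: coeff_skew_unit of_bool_def if_False diff_self simp_thms)
  with assms show False by contradiction
qed

lemma eq_bar_iff: "bar p = q \<longleftrightarrow> p = bar q"
  by (metis bar_bar)

lemma coeff_skew_unit_bar: "coeff (skew_unit p q l $ bar s $ bar r) m
  = - coeff (skew_unit p q l $ r $ s) m"
proof -
  have "(bar s = p \<and> bar r = q \<and> m = l) = (r = bar q \<and> s = bar p \<and> m = l)"
    "(bar s = bar q \<and> bar r = bar p \<and> m = l) = (r = p \<and> s = q \<and> m = l)"
    unfolding eq_bar_iff bar_bar by blast+
  then show ?thesis by (simp only: coeff_skew_unit) simp
qed

lemma skew_unit_skew_graded:
  assumes "in_coset p q l"
  shows "skew_unit p q l \<in> skew_graded"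
proof -
  have "mat_adjoint (skew_unit p q l) = - skew_unit p q l"
    unfolding vec_eq_iff mat_adjoint_nth
    by (intro allI poly_mapping_eqI) (simp add: coeff_skew_unit_bar)
  moreover have "in_coset r s m" if "coeff (skew_unit p q l $ r $ s) m \<noteq> 0" for r s m
    using coeff_skew_unit_nonzeroD[OF that] assms
    by (elim conjE disjE) (simp_all add: in_coset_sym[of q p])
  ultimately show ?thesis
    by (simp add: skew_graded_def graded_def)
qed

lemma skew_unit_nonzero: "q \<noteq> bar p \<Longrightarrow> skew_unit p q l \<noteq> 0"
  using coeff_skew_unit[of p q l p q l] by (intro notI) simp

lemma degree_deriv_skew_unit: "degree_deriv d (skew_unit p q l)
  = mat_scale (pairing d l) (skew_unit p q l)"
proof -
  have "coeff (degree_deriv d (skew_unit p q l) $ r $ s) m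
    = coeff (mat_scale (pairing d l) (skew_unit p q l) $ r $ s) m" for r s m
    by (cases "m = l") (simp_all add: coeff_skew_unit)
  then show ?thesis
    by (simp only: vec_eq_iff poly_mapping_eq_iff fun_eq_iff) simp
qed

lemma trace_mult_mat_unit: "trace (X ** mat_unit p q l) = X $ q $ p * monomial l 1"
proof -
  have "(\<Sum>k\<in>UNIV. X $ a $ k * mat_unit p q l $ k $ a)
    = (\<Sum>k\<in>UNIV. if k = p then (if a = q then X $ q $ p * monomial l 1 else 0) else 0)" for a
    by (rule sum.cong) (simp_all add: mat_unit_nth)
  then have "(X ** mat_unit p q l) $ a $ a = (if a = q then X $ q $ p * monomial l 1 else 0)" for a
    by (simp add: matrix_matrix_mult_def)
  then show ?thesis
    by (simp add: trace_def)
qed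

lemma coeff_mult_monomial: "coeff (f * monomial l a :: laurent) m = coeff f (m - l) * a"
proof (induction f rule: poly_mapping_single_induct)
  case (single k b)
  then show ?case by (auto simp: mult_single lookup_single when_def algebra_simps)
qed (simp_all add: lookup_add algebra_simps)

lemma skew_graded_coeff_bar: "X \<in> skew_graded \<Longrightarrow> X $ bar q $ bar p = - X $ p $ q"
  by (auto simp: skew_graded_def vec_eq_iff)

text \<open>
  Skewness forces the entries \<open>(p, bar p)\<close> to be their own negatives. This is what removes the
  would-be roots of weight \<open>\<plusminus>2\<close>.
\<close>
lemma skew_graded_support:
  assumes "Y \<in> skew_graded" "coeff (Y $ p $ q) l \<noteq> 0"
  shows "in_coset p q l" "q \<noteq> bar p"
proof -
  show "in_coset p q l"
    using assms by (auto simp: skew_graded_def graded_def)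
  show "q \<noteq> bar p"
  proof
    assume "q = bar p"
    then have "Y $ p $ q = - Y $ p $ q"
      using skew_graded_coeff_bar[OF assms(1), of q p] by simp
    then have "coeff (Y $ p $ q) l = - coeff (Y $ p $ q) l"
      by (metis lookup_uminus)
    with assms(2) show False by simp
  qed
qed

text \<open>
  Pairing with \<open>skew_unit p q l\<close> reads off one coefficient. Both terms of the skew unit contribute
  it, hence the factor 2.
\<close>
lemma trace_form_skew_unit:
  assumes "X \<in> skew_graded"
  shows "trace_form X (skew_unit p q l) = 2 * coeff (X $ q $ p) (- l)"
proof -
  have "trace_form X (mat_unit p q l) = coeff (X $ q $ p) (- l)" for p q
    by (simp add: trace_form_def trace_mult_mat_unit coeff_mult_monomial)
  then show ?thesis
    by (simp add: skew_unit_def skew_graded_coeff_bar[OF assms])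
qed

lemma skew_graded_nondegenerate:
  assumes X: "X \<in> skew_graded" and "\<And>p q l. in_coset p q l \<Longrightarrow> trace_form X (skew_unit p q l) = 0"
  shows "X = 0"
proof -
  have "coeff (X $ p $ q) l = 0" for p q l
  proof (rule ccontr)
    assume nz: "coeff (X $ p $ q) l \<noteq> 0"
    then have "in_coset p q l" by (rule skew_graded_support(1)[OF X])
    then have "in_coset q p (- l)" by (auto simp: in_coset_def)
    from assms(2)[OF this] nz show False by (simp add: trace_form_skew_unit[OF X])
  qed
  then show ?thesis by (simp add: vec_eq_iff poly_mapping_eqI)
qed

text \<open>
  Expanding \<open>X\<close> in matrix units and replacing each unit by half the skew unit gives
  \<open>X/2 - (X/2)\<^sup>*\<close>, which is \<open>X\<close> because \<open>X\<close> is skew.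
\<close>
lemma skew_graded_decompose:
  assumes "X \<in> skew_graded"
  shows "X
    = (\<Sum>p\<in>UNIV. \<Sum>q\<in>UNIV. \<Sum>l\<in>Poly_Mapping.keys (X $ p $ q). mat_scale (coeff (X $ p $ q) l / 2)
      (skew_unit p q l))"
proof -
  let ?S =
    "\<Sum>p\<in>UNIV. \<Sum>q\<in>UNIV. \<Sum>l\<in>Poly_Mapping.keys (X $ p $ q).
      mat_scale (coeff (X $ p $ q) l / 2) (mat_unit p q l)"
  have half: "?S $ r $ s = monomial 0 (1/2) * X $ r $ s" for r s
  proof -
    have "?S $ r $ s
      = (\<Sum>p\<in>UNIV. \<Sum>q\<in>UNIV. if q = s then (if p = r then (\<Sum>l\<in>Poly_Mapping.keys
        (X $ p $ q). monomial l (coeff (X $ p $ q) l / 2)) else 0) else 0)"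
      unfolding sum_component
      by (intro sum.cong refl) (auto simp: mat_unit_nth mult_single)
    also have "\<dots> = (\<Sum>l\<in>Poly_Mapping.keys (X $ r $ s). monomial l (coeff (X $ r $ s) l / 2))"
      by simp
    also have "\<dots> = monomial 0 (1/2) * X $ r $ s"
      by (subst (3) poly_mapping_decompose) (simp add: sum_distrib_left mult_single)
    finally show ?thesis .
  qed
  have "(\<Sum>p\<in>UNIV. \<Sum>q\<in>UNIV. \<Sum>l\<in>Poly_Mapping.keys (X $ p $ q).
    mat_scale (coeff (X $ p $ q) l / 2) (mat_unit (bar q) (bar p) l))
    = mat_adjoint ?S"
    unfolding vec_eq_iff mat_adjoint_nth sum_component
    by (intro allI sum.cong refl) (simp add: mat_unit_nth eq_bar_iff conj_commute)
  then have
    "(\<Sum>p\<in>UNIV. \<Sum>q\<in>UNIV. \<Sum>l\<in>Poly_Mapping.keys (X $ p $ q).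
      mat_scale (coeff (X $ p $ q) l / 2) (skew_unit p q l))
    = ?S - mat_adjoint ?S"
    by (simp only: skew_unit_def mat_scale_simps sum_subtractf)
  also have "(?S - mat_adjoint ?S) $ r $ s = X $ r $ s" for r s
    unfolding vector_minus_component mat_adjoint_nth half skew_graded_coeff_bar[OF assms]
    by (rule poly_mapping_eqI)
      (simp only: mult_minus_right diff_minus_eq_add lookup_add coeff_monomial_zero_mult, simp)
  then have "?S - mat_adjoint ?S = X"
    by (simp add: vec_eq_iff)
  finally show ?thesis ..
qed

section \<open>The extended algebra and its Cartan subalgebra\<close>

definition ext_E :: "ext_elem set" where
  "ext_E = {(X, c, d) | X c d. X \<in> skew_graded}"

text \<open>
  The diagonal matrix with the weights on the diagonal.
\<close>
abbreviation h_mat :: mat where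
  "h_mat \<equiv> skew_unit Pos Pos 0"

definition ext_H :: "ext_elem set" where
  "ext_H = {(mat_scale x h_mat, c, d) | x c d. True}"

lemma h_mat_nth: "h_mat $ p $ q = (if p = q then monomial 0 (of_int (wt p)) else 0)"
  by (cases p; cases q) (auto simp: skew_unit_def mat_unit_nth single_uminus)

lemma h_mat_skew_graded [simp]: "h_mat \<in> skew_graded"
  by (rule skew_unit_skew_graded) (simp add: in_coset_def)

lemma mult_h_mat: "(h_mat ** Y) $ p $ q = monomial 0 (of_int (wt p)) * Y $ p $ q"
  "(Y ** h_mat) $ p $ q = Y $ p $ q * monomial 0 (of_int (wt q))"
proof -
  have "(\<Sum>k\<in>UNIV. h_mat $ p $ k * Y $ k $ q)
    = (\<Sum>k\<in>UNIV. if k = p then monomial 0 (of_int (wt p)) * Y $ p $ q else 0)"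
    by (rule sum.cong) (auto simp: h_mat_nth)
  then show "(h_mat ** Y) $ p $ q = monomial 0 (of_int (wt p)) * Y $ p $ q"
    by (simp add: matrix_matrix_mult_def)
  have "(\<Sum>k\<in>UNIV. Y $ p $ k * h_mat $ k $ q)
    = (\<Sum>k\<in>UNIV. if k = q then Y $ p $ q * monomial 0 (of_int (wt q)) else 0)"
    by (rule sum.cong) (auto simp: h_mat_nth)
  then show "(Y ** h_mat) $ p $ q = Y $ p $ q * monomial 0 (of_int (wt q))"
    by (simp add: matrix_matrix_mult_def)
qed

lemma coeff_commutator_h_mat: "coeff (commutator h_mat Y $ p $ q) l
  = of_int (wt p - wt q) * coeff (Y $ p $ q) l"
  by (simp add: commutator_def mult_h_mat lookup_minus coeff_mult_monomial algebra_simps del: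
    single_of_int)

lemma degree_deriv_h_mat [simp]: "degree_deriv d h_mat = 0"
  by (simp add: degree_deriv_skew_unit)

lemma cocycle_h_mat [simp]: "cocycle h_mat Y = 0"
  by (simp add: cocycle_def vec_eq_iff)

lemma trace_form_h_mat: "trace_form h_mat h_mat = 2"
  by (simp add: trace_form_skew_unit coeff_skew_unit)

lemma ext_lie_H: "ext_lie (mat_scale x h_mat, a, b) (Y, c, d)
  = (mat_scale x (commutator h_mat Y) + degree_deriv b Y, 0, 0)"
  by simp

lemma ext_H_subset_ext_E: "ext_H \<subseteq> ext_E"
  by (auto simp: ext_H_def ext_E_def skew_graded_simps)

interpretation ext: vector_space ext_scale
  by (rule vector_space_ext_scale)

interpretation seq: vector_space seq_scale
  by (rule vector_space_seq_scale)

lemma subspace_ext_E: "ext.subspace ext_E"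
  by (auto simp: ext.subspace_def ext_E_def skew_graded_simps zero_prod_def)

lemma mat_scale_add_left: "mat_scale x Y + mat_scale y Y = mat_scale (x + y) Y"
  by simp

lemma subspace_ext_H: "ext.subspace ext_H"
  unfolding ext.subspace_def ext_H_def zero_prod_def
  by (auto simp: mat_scale_add_left simp del: mat_scale_simps(3)) (metis mat_scale_simps(7))+

lemma vec_span: "(c :: complex^6) = (\<Sum>i\<in>UNIV. c $ i *s axis i 1)"
  by (simp add: vec_eq_iff mult_axis)

definition ext_H_basis :: "ext_elem set" where
  "ext_H_basis = insert (h_mat, 0, 0) (range (\<lambda>i. (0, axis i 1, 0)) \<union> range (\<lambda>i. (0, 0, axis i 1)))"

lemma sum_Pair3: "(\<Sum>i\<in>A. (f i, g i, h i)) = (\<Sum>i\<in>A. f i, \<Sum>i\<in>A. g i, \<Sum>i\<in>A. h i)"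
  by (induction A rule: infinite_finite_induct) (auto simp: zero_prod_def)

lemma span_ext_H_basis: "ext.span ext_H_basis = ext_H"
proof
  have "ext_H_basis \<subseteq> ext_H"
    unfolding ext_H_basis_def ext_H_def by auto (metis mat_scale_simps(5,7))+
  then show "ext.span ext_H_basis \<subseteq> ext_H"
    by (intro ext.span_minimal subspace_ext_H)
  show "ext_H \<subseteq> ext.span ext_H_basis"
  proof
    fix u assume "u \<in> ext_H"
    then obtain x c d where u: "u = (mat_scale x h_mat, c, d)" by (auto simp: ext_H_def)
    have "u = ext_scale x (h_mat, 0, 0) + (\<Sum>i\<in>UNIV. ext_scale (c $ i) (0, axis i 1, 0))
      + (\<Sum>i\<in>UNIV. ext_scale (d $ i) (0, 0, axis i 1))"
      by (simp add: u sum_Pair3 flip: vec_span)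
    also have "\<dots> \<in> ext.span ext_H_basis"
      by (intro ext.span_add ext.span_sum ext.span_scale ext.span_base) (auto simp: ext_H_basis_def)
    finally show "u \<in> ext.span ext_H_basis" .
  qed
qed

section \<open>Transport to sequences\<close>

text \<open>
  An element of the extended algebra has countably many complex coordinates, and an enumeration of
  the coordinates turns it into a sequence.
\<close>
type_synonym coord = "(ix \<times> ix \<times> lattice) + (6 + 6)"

lemma countable_coord: "countable (UNIV :: coord set)"
proof -
  have "countable (PiE UNIV (\<lambda>_::6. UNIV :: int set))"
    by (rule countable_PiE) auto
  then have "countable (vec_lambda ` (UNIV :: (6 \<Rightarrow> int) set))"
    by (simp add: PiE_UNIV_domain)
  moreover have "vec_lambda ` (UNIV :: (6 \<Rightarrow> int) set) = UNIV"
    by (metis surjI vec_nth_inverse)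
  ultimately have "countable (UNIV :: lattice set)"
    by simp
  then have "countable ((UNIV :: ix set) \<times> (UNIV :: ix set) \<times> (UNIV :: lattice set))"
    by (intro countable_SIGMA) (auto intro: countable_finite)
  then show ?thesis
    by (simp flip: UNIV_Plus_UNIV)
qed

fun coordinate :: "ext_elem \<Rightarrow> coord \<Rightarrow> complex" where
  "coordinate (X, c, d) (Inl (p, q, l)) = coeff (X $ p $ q) l"
| "coordinate (X, c, d) (Inr (Inl i)) = c $ i"
| "coordinate (X, c, d) (Inr (Inr i)) = d $ i"

definition encode :: "ext_elem \<Rightarrow> nat \<Rightarrow> complex" where
  "encode u = (\<lambda>n. coordinate u (from_nat_into UNIV n))"

definition decode :: "(nat \<Rightarrow> complex) \<Rightarrow> ext_elem" where
  "decode = inv encode"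

lemma inj_encode: "inj encode"
proof (rule injI)
  fix u v assume uv: "encode u = encode v"
  have eq: "coordinate u k = coordinate v k" for k
  proof -
    obtain n where "from_nat_into UNIV n = k"
      using from_nat_into_surj[OF countable_coord, of k] by auto
    then show ?thesis using fun_cong[OF uv, of n] by (simp add: encode_def)
  qed
  obtain X c d Y c' d' where [simp]: "u = (X, c, d)" "v = (Y, c', d')"
    by (metis prod_cases3)
  have "X = Y"
    using eq[of "Inl (p, q, l)" for p q l] by (simp add: vec_eq_iff poly_mapping_eqI)
  moreover have "c = c'"
    using eq[of "Inr (Inl i)" for i] by (simp add: vec_eq_iff)
  moreover have "d = d'"
    using eq[of "Inr (Inr i)" for i] by (simp add: vec_eq_iff)
  ultimately show "u = v" by simp
qed

lemma decode_encode [simp]: "decode (encode u) = u"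
  by (simp add: decode_def inj_encode)

lemma encode_eq_iff [simp]: "encode u = encode v \<longleftrightarrow> u = v"
  using inj_encode by (auto dest: injD)

lemma encode_add: "encode (u + v) = encode u + encode v"
proof -
  have "coordinate (u + v) k = coordinate u k + coordinate v k" for k
    by (cases "(u, k)" rule: coordinate.cases; cases v) (auto simp: lookup_add)
  then show ?thesis by (simp add: encode_def fun_eq_iff)
qed

lemma encode_scale: "encode (ext_scale k u) = seq_scale k (encode u)"
proof -
  have "coordinate (ext_scale a u) k = a * coordinate u k" for a k
    by (cases "(u, k)" rule: coordinate.cases) auto
  then show ?thesis by (simp add: encode_def fun_eq_iff seq_scale_def)
qed

interpretation enc: module_hom ext_scale seq_scale encode
  by unfold_locales (simp_all add: encode_add encode_scale)

text \<open>
  The carrier is the image of an injective linear map, so the Lie algebra identities for sequences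
  are the identities for triples.
\<close>
definition seq_E :: "(nat \<Rightarrow> complex) set" where "seq_E = encode ` ext_E"
definition seq_H :: "(nat \<Rightarrow> complex) set" where "seq_H = encode ` ext_H"
definition seq_lie :: "(nat \<Rightarrow> complex) \<Rightarrow> (nat \<Rightarrow> complex) \<Rightarrow> (nat \<Rightarrow> complex)" where
  "seq_lie x y = encode (ext_lie (decode x) (decode y))"
definition seq_form :: "(nat \<Rightarrow> complex) \<Rightarrow> (nat \<Rightarrow> complex) \<Rightarrow> complex" where
  "seq_form x y = ext_form (decode x) (decode y)"

lemma seq_lie_encode [simp]: "seq_lie (encode u) (encode v) = encode (ext_lie u v)"
  by (simp add: seq_lie_def)

lemma seq_form_encode [simp]: "seq_form (encode u) (encode v) = ext_form u v"
  by (simp add: seq_form_def)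

lemma ext_lie_bilinear:
  "ext_lie (u + v) w = ext_lie u w + ext_lie v w" "ext_lie w (u + v) = ext_lie w u + ext_lie w v"
  "ext_lie (ext_scale k u) w = ext_scale k (ext_lie u w)"
    "ext_lie w (ext_scale k u) = ext_scale k (ext_lie w u)"
  "ext_lie u u = 0"
  by (cases u; cases v; cases w; auto simp: zero_prod_def mat_scale_minus simp flip:
    mat_scale_minus)+

lemma ext_form_bilinear:
  "ext_form (u + v) w = ext_form u w + ext_form v w" "ext_form (ext_scale k u) w = k * ext_form u w"
  by (cases u; cases v; cases w; auto simp: trace_form_sym dot_sym algebra_simps)+

lemma ext_form_sym: "ext_form u v = ext_form v u"
  by (cases u; cases v) (simp add: trace_form_sym[of _ "fst v"] trace_form_sym dot_sym)

lemma ext_E_ext_lie: "u \<in> ext_E \<Longrightarrow> v \<in> ext_E \<Longrightarrow> ext_lie u v \<in> ext_E"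
  by (auto simp: ext_E_def skew_graded_commutator skew_graded_simps)

lemma encode_0 [simp]: "encode 0 = 0"
  by (rule enc.zero)

interpretation seq_alg: lie_algebra seq_scale seq_E seq_lie
proof
  show "seq.subspace seq_E"
    unfolding seq_E_def by (rule enc.subspace_image[OF subspace_ext_E])
qed (unfold seq_E_def, (elim imageE, hypsubst,
    simp add: ext_E_ext_lie ext_lie_bilinear ext_lie_jacobi flip: encode_add encode_scale)+)

interpretation aff: lie_algebra_form_cartan seq_scale seq_E seq_lie seq_form seq_H
proof
  show "seq_alg.subalgebra seq_H"
    unfolding seq_alg.subalgebra_def
  proof (intro conjI ballI)
    show "seq.subspace seq_H"
      unfolding seq_H_def by (rule enc.subspace_image[OF subspace_ext_H])
    show "seq_H \<subseteq> seq_E"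
      using ext_H_subset_ext_E by (auto simp: seq_H_def seq_E_def)
    show "seq_lie x y \<in> seq_H" if "x \<in> seq_H" "y \<in> seq_H" for x y
    proof -
      obtain u v where uv: "x = encode u" "y = encode v" "u \<in> ext_H" "v \<in> ext_H"
        using \<open>x \<in> seq_H\<close> \<open>y \<in> seq_H\<close> by (auto simp: seq_H_def)
      then have "ext_lie u v = 0"
        by (auto simp: ext_H_def zero_prod_def)
      then show ?thesis
        using uv imageI[OF ext.subspace_0[OF subspace_ext_H], of encode] by (simp add: seq_H_def)
    qed
  qed
  show "seq_H \<noteq> {0}"
  proof
    assume "seq_H = {0}"
    moreover have "(0, axis 0 1, 0) \<in> ext_H_basis" by (auto simp: ext_H_basis_def)
    then have "encode (0, axis 0 1, 0) \<in> seq_H"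
      using ext.span_base[of _ ext_H_basis] unfolding span_ext_H_basis seq_H_def by blast
    ultimately have "encode (0, axis 0 1, 0) = encode 0" unfolding encode_0 by blast
    then have "axis 0 1 = (0 :: complex^6)" unfolding encode_eq_iff zero_prod_def by simp
    then show False by (simp add: axis_eq_0_iff)
  qed
  have "finite (encode ` ext_H_basis)" by (simp add: ext_H_basis_def)
  then show "\<exists>B. finite B \<and> seq.span B = seq_H"
    using enc.span_image[of ext_H_basis] by (auto simp: span_ext_H_basis seq_H_def)
  show "seq_form x y = seq_form y x" for x y
    unfolding seq_form_def by (rule ext_form_sym)
qed (unfold seq_E_def,
  (elim imageE, hypsubst, simp add: ext_form_bilinear flip: encode_add encode_scale)+)

section \<open>Root spaces and roots\<close>

definition cartan_elem :: "complex \<Rightarrow> complex^6 \<Rightarrow> complex^6 \<Rightarrow> nat \<Rightarrow> complex" where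
  "cartan_elem x a b = encode (mat_scale x h_mat, a, b)"

lemma seq_H_iff: "h \<in> seq_H \<longleftrightarrow> (\<exists>x a b. h = cartan_elem x a b)"
  by (auto simp: seq_H_def ext_H_def cartan_elem_def)

lemma cartan_elem_seq_H [simp]: "cartan_elem x a b \<in> seq_H"
  by (auto simp: seq_H_iff)

lemma ball_seq_H: "(\<forall>h\<in>seq_H. P h) \<longleftrightarrow> (\<forall>x a b. P (cartan_elem x a b))"
  unfolding Ball_def seq_H_iff by blast

text \<open>
  The coefficient \<open>x\<close> of a matrix \<open>mat_scale x h_mat\<close>, whose \<open>(Pos, Pos)\<close> entry is the constant \<open>x\<close>.
\<close>
fun h_coeff :: "ext_elem \<Rightarrow> complex" where
  "h_coeff (X, c, d) = coeff (X $ Pos $ Pos) 0"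

text \<open>
  The functional \<open>k\<alpha> + l\<close>: it takes \<open>h_mat\<close> to \<open>k\<close>, kills the centre and takes a degree derivation
  to its value on \<open>l\<close>. All roots have this form.
\<close>
definition wt_fun :: "int \<Rightarrow> lattice \<Rightarrow> (nat \<Rightarrow> complex) \<Rightarrow> complex" where
  "wt_fun k l x
    = (if x \<in> seq_H then of_int k * h_coeff (decode x) + pairing (snd (snd (decode x))) l else 0)"

lemma wt_fun_cartan_elem [simp]: "wt_fun k l (cartan_elem x a b) = of_int k * x + pairing b l"
  using cartan_elem_seq_H[of x a b]
    by (simp add: wt_fun_def h_mat_nth cartan_elem_def del: single_of_int)

lemma wt_fun_outside: "x \<notin> seq_H \<Longrightarrow> wt_fun k l x = 0"
  by (simp add: wt_fun_def)

lemma cartan_elem_add: "cartan_elem x a b + cartan_elem y a' b'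
  = cartan_elem (x + y) (a + a') (b + b')"
  by (simp add: cartan_elem_def flip: encode_add)

lemma cartan_elem_scale: "seq_scale k (cartan_elem x a b) = cartan_elem (k * x) (k *s a) (k *s b)"
  by (simp add: cartan_elem_def flip: encode_scale)

lemma wt_fun_dual: "wt_fun k l \<in> aff.dual_H"
  unfolding aff.dual_H_def
    by (auto simp: seq_H_iff cartan_elem_add cartan_elem_scale wt_fun_outside algebra_simps)

lemma wt_fun_eqI:
  assumes "\<alpha> \<in> aff.dual_H" "\<And>x a b. \<alpha> (cartan_elem x a b) = of_int k * x + pairing b l"
  shows "\<alpha> = wt_fun k l"
proof
  show "\<alpha> h = wt_fun k l h" for h
    using assms by (cases "h \<in> seq_H") (auto simp: seq_H_iff[of h] aff.dual_H_def wt_fun_outside)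
qed

lemma wt_fun_eq_iff: "wt_fun k l = wt_fun k' l' \<longleftrightarrow> k = k' \<and> l = l'"
proof
  assume eq: "wt_fun k l = wt_fun k' l'"
  have "k = k'"
    using fun_cong[OF eq, of "cartan_elem 1 0 0"] by simp
  moreover have "l $ i = l' $ i" for i
    using fun_cong[OF eq, of "cartan_elem 0 0 (axis i 1)"] by simp
  ultimately show "k = k' \<and> l = l'" by (simp add: vec_eq_iff)
qed simp

lemma wt_fun_add: "wt_fun k l + wt_fun k' l' = wt_fun (k + k') (l + l')"
  by (rule ext) (simp add: wt_fun_def algebra_simps)

lemma wt_fun_zero: "wt_fun 0 0 = 0"
  by (rule ext) (simp add: wt_fun_def)

text \<open>
  The Cartan subalgebra acts diagonally on the coefficients of the matrix entries and trivially on
  the other two components.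
\<close>
lemma in_root_space:
  "encode (Y, c, d) \<in> aff.root_space \<alpha> \<longleftrightarrow> Y \<in> skew_graded \<and>
    (\<forall>x a b. (\<forall>p q l. (of_int (wt p - wt q) * x + pairing b l - \<alpha> (cartan_elem x a b)) * coeff
      (Y $ p $ q) l = 0)
      \<and> \<alpha> (cartan_elem x a b) *s c = 0 \<and> \<alpha> (cartan_elem x a b) *s d = 0)"
proof -
  have "seq_lie (cartan_elem x a b) (encode (Y, c, d))
    = seq_scale (\<alpha> (cartan_elem x a b)) (encode (Y, c, d)) \<longleftrightarrow>
     (\<forall>p q l. (of_int (wt p - wt q) * x + pairing b l - \<alpha> (cartan_elem x a b)) * coeff
       (Y $ p $ q) l = 0)
      \<and> \<alpha> (cartan_elem x a b) *s c = 0 \<and> \<alpha> (cartan_elem x a b) *s d = 0" for x a b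
  proof -
    have "mat_scale x (commutator h_mat Y) + degree_deriv b Y
      = mat_scale (\<alpha> (cartan_elem x a b)) Y \<longleftrightarrow>
      (\<forall>p q l. (of_int (wt p - wt q) * x + pairing b l - \<alpha> (cartan_elem x a b)) * coeff
        (Y $ p $ q) l = 0)"
      unfolding vec_eq_iff poly_mapping_eq_iff fun_eq_iff
      by (simp add: lookup_add coeff_commutator_h_mat algebra_simps coeff_mult_monomial)
    then show ?thesis
      by (simp add: cartan_elem_def ext_lie_H flip: encode_scale del: ext_lie.simps)
  qed
  moreover have "encode (Y, c, d) \<in> seq_E \<longleftrightarrow> Y \<in> skew_graded"
    by (auto simp: seq_E_def ext_E_def)
  ultimately show ?thesis
    by (simp add: aff.root_space_def ball_seq_H)
qed

lemma skew_unit_root_space: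
  assumes "in_coset p q l"
  shows "encode (skew_unit p q l, 0, 0) \<in> aff.root_space (wt_fun (wt p - wt q) l)"
proof -
  have "(of_int (wt r - wt s) * x + pairing b m - (of_int (wt p - wt q) * x + pairing b l)) * coeff
    (skew_unit p q l $ r $ s) m = 0"
    for r s m x b
  proof -
    show ?thesis
    proof (cases "coeff (skew_unit p q l $ r $ s) m = 0")
      case False
      then have "wt r - wt s = wt p - wt q" "m = l"
        using coeff_skew_unit_nonzeroD[of p q l r s m] by auto
      then show ?thesis by (simp only:) simp
    qed simp
  qed
  then show ?thesis
    by (simp add: in_root_space skew_unit_skew_graded[OF assms] del: of_int_diff)
qed

definition root_labels :: "(int \<times> lattice) set" where
  "root_labels = {(wt p - wt q, l) | p q l. q \<noteq> bar p \<and> in_coset p q l}"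

lemma zero_in_root_labels: "(0, 0) \<in> root_labels"
proof -
  have "(wt Pos - wt Pos, 0) \<in> root_labels"
    unfolding root_labels_def by (intro CollectI exI[of _ Pos] exI[of _ "0::lattice"])
      (simp add: in_coset_def)
  then show ?thesis by simp
qed

text \<open>
  A non-zero coefficient of a root vector determines the functional. If there is none, then a
  central or derivation component is non-zero, and the root is 0.
\<close>
lemma roots_eq: "aff.roots = {wt_fun k l | k l. (k, l) \<in> root_labels}"
proof (intro set_eqI iffI)
  fix \<alpha> assume "\<alpha> \<in> aff.roots"
  then have dual: "\<alpha> \<in> aff.dual_H" and ne: "aff.root_space \<alpha> \<noteq> {0}"
    by (auto simp: aff.roots_def)
  have "encode (0, 0, 0) \<in> aff.root_space \<alpha>"
    by (simp add: in_root_space skew_graded_simps)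
  then have "0 \<in> aff.root_space \<alpha>"
    using encode_0 by (simp add: zero_prod_def)
  with ne obtain y where y: "y \<in> aff.root_space \<alpha>" "y \<noteq> 0" by blast
  then have "y \<in> seq_E"
    by (simp add: aff.root_space_def)
  then obtain Y c d where Y: "y = encode (Y, c, d)"
    by (auto simp: seq_E_def)
  note space = y(1)[unfolded Y in_root_space]
  have nz: "Y \<noteq> 0 \<or> c \<noteq> 0 \<or> d \<noteq> 0"
    using y(2) encode_0 by (auto simp: Y zero_prod_def)
  show "\<alpha> \<in> {wt_fun k l | k l. (k, l) \<in> root_labels}"
  proof (cases "Y = 0")
    case False
    then obtain p q l where pql: "coeff (Y $ p $ q) l \<noteq> 0"
      by (auto simp: vec_eq_iff poly_mapping_eq_iff fun_eq_iff)
    have "\<alpha> = wt_fun (wt p - wt q) l"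
    proof (rule wt_fun_eqI[OF dual])
      fix x a b
      have "(of_int (wt p - wt q) * x + pairing b l - \<alpha> (cartan_elem x a b)) * coeff (Y $ p $ q) l
        = 0"
        using space by blast
      with pql show "\<alpha> (cartan_elem x a b) = of_int (wt p - wt q) * x + pairing b l"
        by (simp del: of_int_diff)
    qed
    moreover have "Y \<in> skew_graded"
      using space by blast
    ultimately show ?thesis
      using skew_graded_support[OF _ pql] unfolding root_labels_def by blast
  next
    case True
    have "\<alpha> (cartan_elem x a b) = 0" for x a b
    proof -
      have "\<alpha> (cartan_elem x a b) *s c = 0" "\<alpha> (cartan_elem x a b) *s d = 0"
        using space by blast+
      with True nz show ?thesis by (auto simp: vec_eq_iff)
    qed
    then have "\<alpha> = wt_fun 0 0"
      by (intro wt_fun_eqI[OF dual]) simp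
    then show ?thesis using zero_in_root_labels by blast
  qed
next
  fix \<alpha> assume "\<alpha> \<in> {wt_fun k l | k l. (k, l) \<in> root_labels}"
  then obtain p q l where pq: "\<alpha> = wt_fun (wt p - wt q) l" "q \<noteq> bar p" "in_coset p q l"
    by (auto simp: root_labels_def)
  have "encode (skew_unit p q l, 0, 0) \<noteq> encode 0"
    using skew_unit_nonzero[OF pq(2)] by (simp add: zero_prod_def)
  then show "\<alpha> \<in> aff.roots"
    using skew_unit_root_space[OF pq(3)] by (auto simp: aff.roots_def pq(1) wt_fun_dual)
qed

definition lattice_vec :: "lattice \<Rightarrow> complex^6" where
  "lattice_vec l = (\<chi> i. of_int (l $ i))"

lemma dot_lattice_vec: "dot b (lattice_vec l) = pairing b l"
  by (simp add: dot_def lattice_vec_def pairing_def)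

lemma seq_form_cartan_elem: "seq_form (cartan_elem x a b) (cartan_elem y a' b')
  = 2 * x * y + dot a b' + dot b a'"
  by (simp add: cartan_elem_def trace_form_h_mat)

text \<open>
  The form pairs derivations with the centre, so the degree part of the functional is represented
  by a central element; the factor \<open>1/2\<close> comes from \<open>trace_form h_mat h_mat = 2\<close>.
\<close>
lemma dual_vec_wt_fun: "aff.dual_vec (wt_fun k l) = cartan_elem (of_int k / 2) (lattice_vec l) 0"
  unfolding aff.dual_vec_def
proof (rule the_equality)
  show "cartan_elem (of_int k / 2) (lattice_vec l) 0 \<in> seq_H
    \<and> (\<forall>h\<in>seq_H. wt_fun k l h = seq_form h (cartan_elem (of_int k / 2) (lattice_vec l) 0))"
    by (simp add: ball_seq_H seq_form_cartan_elem dot_lattice_vec)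
next
  fix t assume t: "t \<in> seq_H \<and> (\<forall>h\<in>seq_H. wt_fun k l h = seq_form h t)"
  then obtain y a b where teq: "t = cartan_elem y a b" by (auto simp: seq_H_iff)
  have eq: "of_int k * x + pairing d l = 2 * x * y + dot c b + dot d a" for x c d
  proof -
    have "wt_fun k l (cartan_elem x c d) = seq_form (cartan_elem x c d) t" using t cartan_elem_seq_H
      by blast
    then show ?thesis by (simp only: wt_fun_cartan_elem teq seq_form_cartan_elem)
  qed
  have "y = of_int k / 2" using eq[of 1 0 0] by simp
  moreover have "b = 0"
    using eq[where x=0 and d=0 and c="axis i 1" for i]
      by (simp add: vec_eq_iff dot_sym[of "axis _ _"])
  moreover have "a = lattice_vec l"
    using eq[where x=0 and c=0 and d="axis i 1" for i]
      by (simp add: vec_eq_iff lattice_vec_def dot_sym[of "axis _ _"])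
  ultimately show "t = cartan_elem (of_int k / 2) (lattice_vec l) 0" by (simp only: teq)
qed

lemma dual_form_wt_fun: "aff.dual_form (wt_fun k l) (wt_fun k' l') = of_int (k * k') / 2"
  unfolding aff.dual_form_def dual_vec_wt_fun seq_form_cartan_elem by simp

lemma isotropic_eq: "aff.isotropic_roots = {wt_fun 0 l | l. (0, l) \<in> root_labels}"
  by (auto simp: aff.isotropic_roots_def roots_eq dual_form_wt_fun)

lemma nonisotropic_eq: "aff.nonisotropic_roots = {wt_fun k l | k l. k \<noteq> 0 \<and> (k, l) \<in> root_labels}"
  by (auto simp: aff.nonisotropic_roots_def isotropic_eq roots_eq wt_fun_eq_iff)

lemma root_labels_range:
  assumes "(k, l) \<in> root_labels"
  shows "k \<in> {-1, 0, 1}"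
proof -
  obtain p q where "k = wt p - wt q" "q \<noteq> bar p"
    using assms by (auto simp: root_labels_def)
  then show ?thesis
    by (cases p; cases q) auto
qed

section \<open>Non-degeneracy, root space decomposition and nilpotency\<close>

lemma (in lie_algebra_form_cartan) root_space_lie:
  assumes x: "x \<in> root_space \<alpha>" and y: "y \<in> root_space \<beta>"
  shows "lie x y \<in> root_space (\<alpha> + \<beta>)"
  unfolding root_space_def
proof (intro CollectI conjI ballI)
  have E: "x \<in> E" "y \<in> E" using x y by (auto simp: root_space_def)
  show "lie x y \<in> E" using E by (rule lie_closed)
  fix h assume h: "h \<in> H"
  then have hE: "h \<in> E" using subalgebra_H by (auto simp: subalgebra_def)
  have anti: "lie a b = - lie b a" if "a \<in> E" "b \<in> E" for a b
  proof -
    have ab: "a + b \<in> E" using that subspace_add[OF subspace_carrier] by blast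
    have "0 = lie (a + b) (a + b)" using lie_alternating[OF ab] by simp
    also have "\<dots> = lie a b + lie b a"
      using that ab by (simp only: lie_add_left lie_add_right) (simp add: lie_alternating)
    finally show ?thesis by (simp add: eq_neg_iff_add_eq_0)
  qed
  have hx: "lie h x = scale (\<alpha> h) x" and hy: "lie h y = scale (\<beta> h) y"
    using x y h by (auto simp: root_space_def)
  have "lie h (lie x y) = - lie x (lie y h) - lie y (lie h x)"
    using jacobi[OF hE E] by (simp add: eq_neg_iff_add_eq_0 algebra_simps)
  also have "lie y h = scale (- \<beta> h) y"
    using anti[OF E(2) hE] by (simp add: hy)
  also have "lie y (lie h x) = scale (- \<alpha> h) (lie x y)"
    using anti[OF E(2,1)] E by (simp add: hx lie_scale_right scale_minus_left)
  finally show "lie h (lie x y) = scale ((\<alpha> + \<beta>) h) (lie x y)"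
    using E by (simp only: lie_scale_right) (simp add: scale_left_distrib scale_minus_left)
qed

lemma root_space_empty: "(k, l) \<notin> root_labels \<Longrightarrow> aff.root_space (wt_fun k l) = {0}"
proof -
  assume "(k, l) \<notin> root_labels"
  then have "wt_fun k l \<notin> aff.roots"
    by (auto simp: roots_eq wt_fun_eq_iff)
  then show ?thesis
    using wt_fun_dual[of k l] unfolding aff.roots_def by blast
qed

lemma ext_E_nondegenerate:
  assumes "u \<in> ext_E" "\<And>v. v \<in> ext_E \<Longrightarrow> ext_form u v = 0"
  shows "u = 0"
proof -
  obtain X c d where u: "u = (X, c, d)" "X \<in> skew_graded" using assms(1) by (auto simp: ext_E_def)
  have "X = 0"
  proof (rule skew_graded_nondegenerate[OF u(2)])
    show "trace_form X (skew_unit p q l) = 0" if "in_coset p q l" for p q l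
      using assms(2)[of "(skew_unit p q l, 0, 0)"] skew_unit_skew_graded[OF that]
        by (simp add: u ext_E_def)
  qed
  moreover have "c = 0"
  proof -
    have "(0, 0, axis i 1) \<in> ext_E" for i by (simp add: ext_E_def skew_graded_simps)
    from assms(2)[OF this] show ?thesis by (simp add: u vec_eq_iff[of c])
  qed
  moreover have "d = 0"
  proof -
    have "(0, axis i 1, 0) \<in> ext_E" for i by (simp add: ext_E_def skew_graded_simps)
    from assms(2)[OF this] show ?thesis by (simp add: u vec_eq_iff[of d])
  qed
  ultimately show ?thesis by (simp add: u zero_prod_def)
qed

lemma seq_H_root_space: "aff.root_space 0 = seq_H"
proof (intro set_eqI iffI)
  fix y assume y: "y \<in> aff.root_space 0"
  then have "y \<in> seq_E" by (simp add: aff.root_space_def)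
  then obtain Y c d where Y: "y = encode (Y, c, d)"
    by (auto simp: seq_E_def)
  note space = y[unfolded Y in_root_space]
  \<comment> \<open>Only the diagonal constants in the rows \<open>Pos\<close> and \<open>Neg\<close> survive, and skewness makes
    them opposite.\<close>
  have supp: "l = 0 \<and> p = q \<and> q \<noteq> bar p" if nz: "coeff (Y $ p $ q) l \<noteq> 0" for p q l
  proof -
    have eq: "of_int (wt p - wt q) * x + pairing b l = 0" for x b
    proof -
      have "(of_int (wt p - wt q) * x + pairing b l
        - (0 :: (nat \<Rightarrow> complex) \<Rightarrow> complex) (cartan_elem x 0 b)) * coeff (Y $ p $ q) l = 0"
        using space by blast
      with nz show ?thesis by (simp del: of_int_diff)
    qed
    have "wt p = wt q"
      using eq[of 1 0] by simp
    moreover have "l $ i = 0" for i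
      using eq[of 0 "axis i 1"] by simp
    then have "l = 0" by (simp add: vec_eq_iff)
    moreover have Y: "Y \<in> skew_graded" using space by blast
    ultimately show ?thesis
      using skew_graded_support[OF Y nz] deg_distinct[of p q] by simp
  qed
  have "coeff (Y $ p $ q) l = coeff (mat_scale (coeff (Y $ Pos $ Pos) 0) h_mat $ p $ q) l" for p q l
  proof (cases "p = q \<and> l = 0")
    case False
    then have "coeff (Y $ p $ q) l = 0" using supp by blast
    with False show ?thesis by (auto simp: h_mat_nth lookup_single when_def simp del: single_of_int)
  next
    case True
    have "Y $ Neg $ Neg = - Y $ Pos $ Pos"
      using skew_graded_coeff_bar[of Y Pos Pos] space by simp
    moreover have "coeff (Y $ q $ q) 0 = 0 \<or> q = Pos \<or> q = Neg"
      using supp[of q q 0] by (cases q) auto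
    ultimately show ?thesis
      using True by (cases q) (auto simp add: h_mat_nth simp del: single_of_int)
  qed
  then have "Y = mat_scale (coeff (Y $ Pos $ Pos) 0) h_mat"
    by (intro vec_eq_iff[THEN iffD2] allI poly_mapping_eqI)
  then obtain x where "Y = mat_scale x h_mat" ..
  then have "y = cartan_elem x c d"
    by (simp add: cartan_elem_def Y)
  then show "y \<in> seq_H" by simp
next
  fix y assume "y \<in> seq_H"
  then obtain x a b where "y = cartan_elem x a b" by (auto simp: seq_H_iff)
  moreover have
    "(of_int (wt p - wt q) * x' + pairing b' l - 0) * coeff (mat_scale x h_mat $ p $ q) l = 0"
      for p q l x' b'
    by (cases "p = q"; cases "l = 0")
      (simp_all add: h_mat_nth lookup_single when_def del: single_of_int)
  ultimately show "y \<in> aff.root_space 0"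
    by (simp add: cartan_elem_def in_root_space skew_graded_simps)
qed

lemma seq_E_decomposition: "seq_E = seq.span (\<Union>\<alpha>\<in>aff.roots. aff.root_space \<alpha>)"
proof
  show "seq.span (\<Union>\<alpha>\<in>aff.roots. aff.root_space \<alpha>) \<subseteq> seq_E"
    by (rule seq.span_minimal) (auto simp: aff.root_space_def intro: seq_alg.subspace_carrier)
  show "seq_E \<subseteq> seq.span (\<Union>\<alpha>\<in>aff.roots. aff.root_space \<alpha>)" (is "_ \<subseteq> ?S")
  proof
    fix y assume "y \<in> seq_E"
    then obtain X c d where X: "y = encode (X, c, d)" "X \<in> skew_graded"
      by (auto simp: seq_E_def ext_E_def)
    have "0 \<in> aff.roots"
      using zero_in_root_labels by (auto simp: roots_eq simp flip: wt_fun_zero)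
    then have "seq_H \<subseteq> ?S"
      using seq_H_root_space by (auto intro: seq.span_base)
    moreover have "encode (0, c, d) \<in> seq_H"
      using cartan_elem_seq_H[of 0 c d] by (simp add: cartan_elem_def)
    ultimately have 1: "encode (0, c, d) \<in> ?S" by blast
    have root_vec: "encode (skew_unit p q l, 0, 0) \<in> ?S" if "coeff (X $ p $ q) l \<noteq> 0" for p q l
    proof -
      have "wt_fun (wt p - wt q) l \<in> aff.roots"
        using skew_graded_support[OF X(2) that] unfolding roots_eq root_labels_def by blast
      then show ?thesis
        using skew_unit_root_space[OF skew_graded_support(1)[OF X(2) that]]
          by (intro seq.span_base) blast
    qed
    have "(X, 0, 0) = (\<Sum>p\<in>UNIV. \<Sum>q\<in>UNIV. \<Sum>l\<in>Poly_Mapping.keys (X $ p $ q).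
        ext_scale (coeff (X $ p $ q) l / 2) (skew_unit p q l, 0, 0))"
      using skew_graded_decompose[OF X(2)] by (simp add: sum_Pair3)
    then have "encode (X, 0, 0) = (\<Sum>p\<in>UNIV. \<Sum>q\<in>UNIV. \<Sum>l\<in>Poly_Mapping.keys (X $ p $ q).
        seq_scale (coeff (X $ p $ q) l / 2) (encode (skew_unit p q l, 0, 0)))"
      by (simp only: enc.sum encode_scale)
    also have "\<dots> \<in> ?S"
      by (intro seq.span_sum seq.span_scale root_vec) (simp add: in_keys_iff)
    finally have "encode (X, 0, 0) + encode (0, c, d) \<in> ?S"
      using 1 by (rule seq.span_add)
    then show "y \<in> ?S"
      by (simp add: X flip: encode_add)
  qed
qed

lemma iterate_root_space:
  assumes "x \<in> aff.root_space (wt_fun k l)" "y \<in> aff.root_space (wt_fun k' l')"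
  shows "\<exists>l''. (seq_lie x ^^ n) y \<in> aff.root_space (wt_fun (k' + int n * k) l'')"
proof (induction n)
  case (Suc n)
  then obtain l'' where "(seq_lie x ^^ n) y \<in> aff.root_space (wt_fun (k' + int n * k) l'')" by blast
  from aff.root_space_lie[OF assms(1) this] show ?case
    by (auto simp: wt_fun_add algebra_simps)
qed (use assms in auto)

text \<open>
  Weights of roots lie between -1 and 1, so shifting three times by \<open>\<plusminus>1\<close> leaves this range and
  annihilates every root space.
\<close>
lemma ad_nilpotent:
  assumes "\<alpha> \<in> aff.nonisotropic_roots" "x \<in> aff.root_space \<alpha>"
  shows "seq_alg.locally_nilpotent_ad x"
proof -
  obtain k l where \<alpha>: "\<alpha> = wt_fun k l" "k \<noteq> 0" "(k, l) \<in> root_labels"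
    using assms(1) by (auto simp: nonisotropic_eq)
  have xE: "x \<in> seq_E" using assms(2) by (simp add: aff.root_space_def)
  have decomposition: "seq_E = seq.span (\<Union>\<alpha>\<in>aff.roots. aff.root_space \<alpha>)"
    by (rule seq_E_decomposition)
  have lie0: "seq_lie x 0 = 0"
    using seq_alg.lie_scale_right[OF xE xE, of 0] by simp
  have "y \<in> seq_E \<and> (seq_lie x ^^ 3) y = 0" if "y \<in> seq_E" for y
  proof (rule seq.span_induct[of y "\<Union>\<alpha>\<in>aff.roots. aff.root_space \<alpha>"
    "\<lambda>y. y \<in> seq_E \<and> (seq_lie x ^^ 3) y = 0"])
    show "y \<in> seq.span (\<Union>\<alpha>\<in>aff.roots. aff.root_space \<alpha>)"
      using that by (rule subst[OF decomposition])
  next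
    show "seq.subspace {y. y \<in> seq_E \<and> (seq_lie x ^^ 3) y = 0}"
      using xE seq_alg.subspace_carrier lie0
      by (simp add: seq.subspace_def eval_nat_numeral seq_alg.lie_closed seq_alg.lie_add_right
        seq_alg.lie_scale_right)
  next
    fix y assume "y \<in> (\<Union>\<alpha>\<in>aff.roots. aff.root_space \<alpha>)"
    then obtain k' l' where y: "y \<in> aff.root_space (wt_fun k' l')" "(k', l') \<in> root_labels"
      by (auto simp: roots_eq)
    obtain l'' where "(seq_lie x ^^ 3) y \<in> aff.root_space (wt_fun (k' + int 3 * k) l'')"
      using iterate_root_space[OF assms(2)[unfolded \<alpha>] y(1)] by blast
    moreover have "(k' + int 3 * k, l'') \<notin> root_labels"
      using root_labels_range[of
        "k' + int 3 * k" l''] root_labels_range[OF \<alpha>(3)] root_labels_range[OF y(2)] \<alpha>(2) by auto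
    ultimately have "(seq_lie x ^^ 3) y = 0"
      by (simp add: root_space_empty)
    moreover have "y \<in> seq_E" using y by (simp add: aff.root_space_def)
    ultimately show "y \<in> seq_E \<and> (seq_lie x ^^ 3) y = 0"
      by simp
  qed
  then show ?thesis unfolding seq_alg.locally_nilpotent_ad_def by blast
qed

lemma nonisotropic_not_orthogonal:
  "\<alpha> \<in> aff.nonisotropic_roots \<Longrightarrow> \<beta> \<in> aff.nonisotropic_roots \<Longrightarrow> aff.dual_form \<alpha> \<beta> \<noteq> 0"
  by (auto simp: nonisotropic_eq dual_form_wt_fun)

section \<open>The core and its centralizer\<close>

lemma vec_lambda_zero [simp]: "(\<chi> i. 0) = 0"
  by (simp add: zero_vec_def)

lemma commutator_h_mat_skew_unit: "commutator h_mat (skew_unit p q l)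
  = mat_scale (of_int (wt p - wt q)) (skew_unit p q l)"
proof -
  have "coeff (commutator h_mat (skew_unit p q l) $ r $ s) m
    = coeff (mat_scale (of_int (wt p - wt q)) (skew_unit p q l) $ r $ s) m" for r s m
  proof (cases "coeff (skew_unit p q l $ r $ s) m = 0")
    case False
    then have "wt r - wt s = wt p - wt q"
      using coeff_skew_unit_nonzeroD[of p q l r s m] by auto
    then show ?thesis by (simp only: coeff_commutator_h_mat mat_scale_nth coeff_monomial_zero_mult)
  qed (simp add: coeff_commutator_h_mat)
  then show ?thesis
    by (intro vec_eq_iff[THEN iffD2] allI poly_mapping_eqI)
qed

text \<open>
  Brackets of root vectors of weight \<open>-1\<close> and \<open>1\<close> give all of the weight 0 part: the skew units
  between distinct neutral indices, and for \<open>i = j\<close> the multiples of \<open>h_mat\<close> by monomials.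
\<close>
lemma commutator_skew_unit_neutral:
  assumes "wt i = 0" "wt j = 0"
  shows "commutator (skew_unit i Pos l) (skew_unit Pos j m)
    = (if i = j then - skew_unit Pos Pos (l + m) else skew_unit i j (l + m))"
proof -
  have "i \<noteq> Pos" "i \<noteq> Neg" "bar i = i" "j \<noteq> Pos" "j \<noteq> Neg" "bar j = j"
    using assms by (cases i; cases j; simp)+
  then show ?thesis
    by (auto simp: commutator_def skew_unit_def matrix_ring_simps mat_unit_mult add.commute)
qed

lemma trace_form_skew_unit_neutral:
  assumes "wt i = 0" "wt j = 0" "in_coset i Pos l"
  shows "trace_form (skew_unit i Pos l) (skew_unit Pos j m) = (if i = j \<and> m = - l then 2 else 0)"
  using assms
    by (cases i; cases j)
      (auto simp: trace_form_skew_unit[OF skew_unit_skew_graded] coeff_skew_unit)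

lemma cocycle_skew_unit: "cocycle (skew_unit p q l) Y
  = (\<chi> n. of_int (l $ n) * trace_form (skew_unit p q l) Y)"
  by (simp add: cocycle_def degree_deriv_skew_unit vec_eq_iff)

lemma root_vector_nonisotropic:
  assumes "wt p \<noteq> wt q" "q \<noteq> bar p" "in_coset p q l"
  shows "\<exists>\<alpha>\<in>aff.nonisotropic_roots. encode (skew_unit p q l, 0, 0) \<in> aff.root_space \<alpha>"
proof -
  have "(wt p - wt q, l) \<in> root_labels" unfolding root_labels_def using assms(2,3) by blast
  then have "wt_fun (wt p - wt q) l \<in> aff.nonisotropic_roots"
    unfolding nonisotropic_eq using assms(1) by (intro CollectI exI conjI refl) simp_all
  then show ?thesis using skew_unit_root_space[OF assms(3)] by blast
qed

lemma root_vector_core: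
  assumes "wt p \<noteq> wt q" "q \<noteq> bar p" "in_coset p q l"
  shows "encode (skew_unit p q l, 0, 0) \<in> aff.core"
  unfolding aff.core_def by (rule hull_inc) (use root_vector_nonisotropic[OF assms] in blast)

text \<open>
  The bracket of opposite root vectors of degrees \<open>l\<close> and \<open>-l\<close> is \<open>-h_mat\<close> plus the central element
  \<open>2l\<close>. Comparing \<open>l = 0\<close> with the basis vectors of the lattice isolates the centre.
\<close>
lemma central_in_core: "encode (0, c, 0) \<in> aff.core"
proof -
  have "encode (0, c, 0) \<in> t"
    if t: "seq_alg.subalgebra t" and sub: "(\<Union>\<alpha>\<in>aff.nonisotropic_roots. aff.root_space \<alpha>) \<subseteq> t" for t
  proof -
    have st: "seq.subspace t" and lt: "\<And>x y. x \<in> t \<Longrightarrow> y \<in> t \<Longrightarrow> seq_lie x y \<in> t"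
      using t by (auto simp: seq_alg.subalgebra_def)
    have root_vec: "encode (skew_unit p q l, 0, 0) \<in> t" if "wt p \<noteq> wt q" "q \<noteq> bar p"
      "in_coset p q l" for p q l
      using root_vector_nonisotropic[OF that] sub by blast
    have *: "encode (- h_mat, \<chi> n. 2 * of_int (l $ n), 0) \<in> t" if "wt i = 0" "in_coset i Pos l"
      for i l
    proof -
      have i: "i \<noteq> Neg" "bar i \<noteq> Pos" using that(1) by (cases i; simp)+
      have "in_coset Pos i (- l)" using that(2) by (auto simp: in_coset_def)
      then have "seq_lie (encode (skew_unit i Pos l, 0, 0)) (encode (skew_unit Pos i (- l), 0, 0))
        \<in> t"
        using that i by (intro lt root_vec) (auto simp: eq_commute[of Pos])
      then show ?thesis
        using that
          by (simp add: commutator_skew_unit_neutral cocycle_skew_unit trace_form_skew_unit_neutral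
            mult.commute)
    qed
    have "encode (0, axis i 2, 0) \<in> t" for i
    proof -
      have "encode (- h_mat, \<chi> n. 2 * of_int (axis i 1 $ n), 0)
        - encode (- h_mat, \<chi> n. 2 * of_int ((0::lattice) $ n), 0) \<in> t"
        using *[of "Gen i" "axis i 1"] *[of Zero 0]
          by (intro seq.subspace_diff[OF st]) (auto simp: in_coset_def)
      moreover have "(\<chi> n. 2 * of_int (axis i 1 $ n)) = (axis i 2 :: complex^6)"
        by (simp add: vec_eq_iff axis_def)
      moreover have "(\<chi> n. 2 * of_int ((0::lattice) $ n)) = (0 :: complex^6)"
        by (simp add: vec_eq_iff)
      ultimately show ?thesis by (simp flip: enc.diff)
    qed
    then have "(\<Sum>i\<in>UNIV. seq_scale (c $ i / 2) (encode (0, axis i 2, 0))) \<in> t"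
      by (intro seq.subspace_sum[OF st] seq.subspace_scale[OF st])
    moreover have "(\<Sum>i\<in>UNIV. seq_scale (c $ i / 2) (encode (0, axis i 2, 0))) = encode (0, c, 0)"
    proof -
      have "(\<Sum>i\<in>UNIV. (c $ i / 2) *s axis i 2) = c"
        by (simp add: vec_eq_iff mult_axis)
      then show ?thesis by (simp add: sum_Pair3 flip: encode_scale enc.sum)
    qed
    ultimately show ?thesis by simp
  qed
  then show ?thesis by (auto simp: aff.core_def hull_def)
qed

text \<open>
  Let \<open>z\<close> centralize the core. By invariance \<open>z\<close> is orthogonal to \<open>[u, v]\<close> whenever \<open>u\<close> is in the
  core, and these brackets exhaust the skew units: brackets with \<open>h_mat\<close> give those of non-zero
  weight, and the lemma on neutral indices gives the others. The trace form being non-degenerate,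
  the matrix part of \<open>z\<close> is 0. The derivation part acts on a root vector of degree \<open>\<sigma>\<^sub>i\<close> by its
  \<open>i\<close>-th component, so it vanishes too.
\<close>
lemma core_centralizer: "seq_alg.centralizer aff.core \<subseteq> aff.core"
proof
  fix z assume z: "z \<in> seq_alg.centralizer aff.core"
  then have "z \<in> seq_E" by (simp add: seq_alg.centralizer_def)
  then obtain X c d where X: "z = encode (X, c, d)" "X \<in> skew_graded"
    by (auto simp: seq_E_def ext_E_def)
  have zero: "ext_lie (X, c, d) (skew_unit p q l, 0, 0) = 0" if "wt p \<noteq> wt q" "q \<noteq> bar p"
    "in_coset p q l" for p q l
  proof -
    have "seq_lie z (encode (skew_unit p q l, 0, 0)) = encode 0"
      using z root_vector_core[OF that] unfolding seq_alg.centralizer_def encode_0 by blast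
    then show ?thesis unfolding X(1) seq_lie_encode encode_eq_iff .
  qed
  have orth: "ext_form (X, c, d) (ext_lie (skew_unit p q l, 0, 0) v) = 0"
    if "wt p \<noteq> wt q" "q \<noteq> bar p" "in_coset p q l" for p q l v
    unfolding ext_form_invariant[symmetric] zero[OF that] by (cases v) (simp add: zero_prod_def)
  have "X = 0"
  proof (rule skew_graded_nondegenerate[OF X(2)])
    fix p q l assume a: "in_coset p q l"
    \<comment> \<open>The left factor has degree 0, so no central term appears.\<close>
    have diag: "trace_form X (skew_unit Pos Pos l) = 0" if "in_coset Pos Pos l"
    proof -
      have "commutator (skew_unit Pos Zero 0) (skew_unit Zero Pos l) = skew_unit Pos Pos l"
        using commutator_skew_unit_neutral[of Zero Zero l 0] commutator_antisym[of "skew_unit Pos Zero 0"]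
        by simp
      then show ?thesis
        using orth[of Pos Zero 0 "(skew_unit Zero Pos l, 0, 0)"]
          by (simp add: cocycle_skew_unit in_coset_def)
    qed
    consider "q = bar p" | "wt p \<noteq> wt q" "q \<noteq> bar p" | "wt p = 0" "wt q = 0" "p \<noteq> q"
      | "p = Pos" "q = Pos" | "p = Neg" "q = Neg"
      by (cases p; cases q) auto
    then show "trace_form X (skew_unit p q l) = 0"
    proof cases
      case 1
      then show ?thesis by (simp add: skew_unit_def)
    next
      case 2
      have "ext_lie (skew_unit p q l, 0, 0) (h_mat, 0, 0)
        = (- mat_scale (of_int (wt p - wt q)) (skew_unit p q l), 0, 0)"
        using commutator_antisym[of "skew_unit p q l" h_mat] cocycle_antisym[of
          "skew_unit p q l" h_mat] by (simp add: commutator_h_mat_skew_unit del: of_int_diff)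
      then show ?thesis
        using orth[OF 2 a, of "(h_mat, 0, 0)"] 2(1) by (simp del: of_int_diff ext_lie.simps)
    next
      case 3
      have "in_coset p Pos (deg p)" by (cases p) (auto simp: in_coset_def)
      moreover have "wt p \<noteq> wt Pos" "Pos \<noteq> bar p" using 3 by (cases p; simp)+
      ultimately have "trace_form X (skew_unit p q (deg p + (l - deg p))) = 0"
        using orth[of p Pos "deg p" "(skew_unit Pos q (l - deg p), 0, 0)"] 3
        by (simp add: commutator_skew_unit_neutral cocycle_skew_unit trace_form_skew_unit_neutral)
      then show ?thesis by simp
    next
      case 4
      then show ?thesis using diag a by simp
    next
      case 5
      have "skew_unit Neg Neg l = - skew_unit Pos Pos l" by (simp add: skew_unit_def)
      with 5 show ?thesis using diag a by (simp add: in_coset_def)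
    qed
  qed
  moreover have "d = 0"
  proof -
    have "d $ i = 0" for i
    proof -
      have "ext_lie (X, c, d) (skew_unit Pos (Gen i) (axis i 1), 0, 0) = 0"
        by (rule zero) (simp_all add: in_coset_def)
      then have
        "coeff (mat_scale (d $ i) (skew_unit Pos (Gen i) (axis i 1)) $ Pos $ Gen i) (axis i 1) = 0"
        by (simp add: \<open>X = 0\<close> degree_deriv_skew_unit zero_prod_def)
      then show ?thesis by (simp add: coeff_skew_unit)
    qed
    then show ?thesis by (simp add: vec_eq_iff)
  qed
  ultimately show "z \<in> aff.core"
    using central_in_core by (simp add: X)
qed

section \<open>The root lattice\<close>

interpretation int_mod: module int_scale
  by (rule module_int_scale)

interpretation real_vs: vector_space real_scale
  by (rule vector_space_real_scale)

lemma int_scale_wt_fun: "int_scale n (wt_fun k l) = wt_fun (n * k) (n *s l)"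
  by (rule ext) (simp add: int_scale_def wt_fun_def pairing_def sum_distrib_left algebra_simps)

lemma subspace_wt_fun: "int_mod.subspace {wt_fun k l | k l. True}"
  unfolding int_mod.subspace_def
    by (auto simp: wt_fun_add int_scale_wt_fun simp flip: wt_fun_zero) blast+

definition wt_fun_basis :: "((nat \<Rightarrow> complex) \<Rightarrow> complex) set" where
  "wt_fun_basis = insert (wt_fun 1 0) (range (\<lambda>i. wt_fun 0 (axis i 1)))"

lemma root_labels_I: "q \<noteq> bar p \<Longrightarrow> in_coset p q l \<Longrightarrow> k = wt p - wt q \<Longrightarrow> wt_fun k l \<in> aff.roots"
  unfolding roots_eq root_labels_def by blast

lemma isotropic_deg_root: "wt_fun 0 (deg p) \<in> aff.roots"
proof (cases "p = Total \<or> (\<exists>i. p = Gen i)")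
  case True
  then show ?thesis
    by (intro root_labels_I[of p Zero]) (auto simp: in_coset_def)
next
  case False
  then have "deg p = 0" by (cases p) auto
  then show ?thesis
    using root_labels_I[of Pos Pos 0 0] by (simp add: in_coset_def)
qed

lemma wt_fun_basis_roots: "wt_fun_basis \<subseteq> aff.roots"
  using root_labels_I[of Zero Pos 0 1] isotropic_deg_root[of "Gen i" for i]
  by (auto simp: wt_fun_basis_def in_coset_def)

lemma span_wt_fun_basis: "int_mod.span wt_fun_basis = {wt_fun k l | k l. True}"
proof
  show "int_mod.span wt_fun_basis \<subseteq> {wt_fun k l | k l. True}"
    by (intro int_mod.span_minimal subspace_wt_fun) (auto simp: wt_fun_basis_def)
  show "{wt_fun k l | k l. True} \<subseteq> int_mod.span wt_fun_basis"
  proof clarify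
    fix k l
    have "wt_fun k l
      = int_scale k (wt_fun 1 0) + (\<Sum>i\<in>UNIV. int_scale (l $ i) (wt_fun 0 (axis i 1)))"
    proof -
      have "(\<Sum>i\<in>A. int_scale (l $ i) (wt_fun 0 (axis i 1))) = wt_fun 0 (\<Sum>i\<in>A. axis i (l $ i))"
        if "finite A" for A
      proof -
        have axis_scale: "n *s axis i 1 = (axis i n :: lattice)" for n i
          by (simp add: vec_eq_iff axis_def)
        show ?thesis
          using that
            by (induction A) (simp_all add: wt_fun_zero int_scale_wt_fun wt_fun_add axis_scale)
      qed
      moreover have "(\<Sum>i\<in>UNIV. axis i (l $ i)) = l"
        by (simp add: vec_eq_iff axis_def)
      ultimately show ?thesis
        by (simp add: int_scale_wt_fun wt_fun_add)
    qed
    also have "\<dots> \<in> int_mod.span wt_fun_basis"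
      by (intro int_mod.span_add int_mod.span_sum int_mod.span_scale int_mod.span_base)
        (auto simp: wt_fun_basis_def)
    finally show "wt_fun k l \<in> int_mod.span wt_fun_basis" .
  qed
qed

lemma span_roots: "int_mod.span aff.roots = {wt_fun k l | k l. True}"
proof
  show "int_mod.span aff.roots \<subseteq> {wt_fun k l | k l. True}"
    by (intro int_mod.span_minimal subspace_wt_fun) (auto simp: roots_eq)
  show "{wt_fun k l | k l. True} \<subseteq> int_mod.span aff.roots"
    using int_mod.span_mono[OF wt_fun_basis_roots] by (simp add: span_wt_fun_basis)
qed

lemma independent_wt_fun_basis: "\<not> int_mod.dependent wt_fun_basis"
proof
  have fin: "finite wt_fun_basis" by (simp add: wt_fun_basis_def)
  assume "int_mod.dependent wt_fun_basis"
  then obtain u v where v: "v \<in> wt_fun_basis" "u v \<noteq> 0"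
    and sum: "(\<Sum>v\<in>wt_fun_basis. int_scale (u v) v) = 0"
    using int_mod.dependent_finite[OF fin] by blast
  \<comment> \<open>The point dual to \<open>v\<close>: \<open>h_mat\<close> or a coordinate derivation.\<close>
  obtain x where x: "\<And>w. w \<in> wt_fun_basis \<Longrightarrow> w x = (if w = v then 1 else 0)"
  proof (cases "v = wt_fun 1 0")
    case True
    then have "w (cartan_elem 1 0 0) = (if w = v then 1 else 0)" if "w \<in> wt_fun_basis" for w
      using that by (auto simp: wt_fun_basis_def wt_fun_eq_iff)
    then show ?thesis by (rule that)
  next
    case False
    then obtain i where "v = wt_fun 0 (axis i 1)" using v by (auto simp: wt_fun_basis_def)
    moreover have "axis j (1::complex) $ i' = (if i' = j then 1 else 0)" for j i' :: 6
      by (simp add: axis_def)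
    ultimately have "w (cartan_elem 0 0 (axis i 1)) = (if w = v then 1 else 0)"
      if "w \<in> wt_fun_basis" for w
      using that by (auto simp: wt_fun_basis_def wt_fun_eq_iff axis_eq_axis)
    then show ?thesis by (rule that)
  qed
  have "0 = (\<Sum>w\<in>wt_fun_basis. int_scale (u w) w) x"
    by (simp add: sum)
  also have "\<dots> = (\<Sum>w\<in>wt_fun_basis. of_int (u w) * w x)"
    by (induction rule: infinite_finite_induct) (auto simp: int_scale_def)
  also have "\<dots> = (\<Sum>w\<in>wt_fun_basis. if w = v then of_int (u v) else 0)"
    by (rule sum.cong) (auto simp: x)
  also have "\<dots> = of_int (u v)"
    using v fin by simp
  finally show False using v by simp
qed

lemma free_root_lattice: "free_of_finite_rank (int_span aff.roots)"
  unfolding free_of_finite_rank_def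
  using independent_wt_fun_basis span_wt_fun_basis span_roots
    by (intro exI[of _ wt_fun_basis]) (simp add: wt_fun_basis_def)

section \<open>The extended affine Lie algebra and its reducedness\<close>

lemma seq_E_extended_affine: "extended_affine_lie_algebra seq_scale seq_E seq_lie seq_form seq_H"
proof
  show "seq_form (seq_lie x y) z = seq_form x (seq_lie y z)" for x y z
    unfolding seq_lie_def seq_form_def decode_encode by (rule ext_form_invariant)
  show "x = 0" if xE: "x \<in> seq_E" and orth: "\<And>y. y \<in> seq_E \<Longrightarrow> seq_form x y = 0" for x
  proof -
    obtain u where u: "x = encode u" "u \<in> ext_E" using xE unfolding seq_E_def by blast
    have "u = 0"
    proof (rule ext_E_nondegenerate[OF u(2)])
      show "ext_form u v = 0" if "v \<in> ext_E" for v
        using orth[of "encode v"] that by (simp add: u seq_E_def)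
    qed
    then show ?thesis by (simp add: u)
  qed
  show "\<exists>\<alpha>\<in>R1. \<exists>\<beta>\<in>R2. aff.dual_form \<alpha> \<beta> \<noteq> 0"
    if "aff.nonisotropic_roots = R1 \<union> R2" "R1 \<noteq> {}" "R2 \<noteq> {}" for R1 R2
    using that nonisotropic_not_orthogonal by blast
qed (fact seq_E_decomposition seq_H_root_space ad_nilpotent core_centralizer free_root_lattice)+

text \<open>
  Evaluation at \<open>h_mat\<close> is invariant under adding isotropic roots, and it is \<open>1\<close> or \<open>-1\<close> at every
  root of non-zero class, so a factor between two such classes is \<open>\<plusminus>1\<close>.
\<close>
lemma seq_E_reduced: "aff.reduced"
  unfolding aff.reduced_def
proof (intro ballI allI impI)
  fix \<alpha> \<beta> and r :: real
  assume "\<alpha> \<in> aff.roots" "\<beta> \<in> aff.roots" and ne: "aff.root_class \<alpha> \<noteq> aff.root_class 0"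
    "aff.root_class \<beta> \<noteq> aff.root_class 0"
    and eq: "aff.root_class \<beta> = aff.root_class (real_scale r \<alpha>)"
  then obtain k l k' l' where kl: "\<alpha> = wt_fun k l" "(k, l) \<in> root_labels" "\<beta> = wt_fun k' l'"
    "(k', l') \<in> root_labels"
    by (auto simp: roots_eq)
  let ?S = "real_span aff.isotropic_roots"
  have "k'' \<noteq> 0" if "aff.root_class (wt_fun k'' l'') \<noteq> aff.root_class 0" "(k'', l'') \<in> root_labels"
    for k'' l''
  proof
    assume "k'' = 0"
    then have "wt_fun k'' l'' \<in> aff.isotropic_roots" using that(2) by (auto simp: isotropic_eq)
    then have s: "wt_fun k'' l'' \<in> ?S" by (rule real_vs.span_base)
    have "aff.root_class (wt_fun k'' l'') = aff.root_class 0"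
      unfolding aff.root_class_def
    proof (intro set_eqI iffI; clarify)
      fix \<delta> assume "\<delta> \<in> ?S"
      then show "\<exists>\<delta>'. wt_fun k'' l'' + \<delta> = 0 + \<delta>' \<and> \<delta>' \<in> ?S"
        using real_vs.span_add[OF s] by auto
      show "\<exists>\<delta>'. 0 + \<delta> = wt_fun k'' l'' + \<delta>' \<and> \<delta>' \<in> ?S"
        using real_vs.span_diff[OF \<open>\<delta> \<in> ?S\<close> s] by (intro exI[of _ "\<delta> - wt_fun k'' l''"]) simp
    qed
    with that(1) show False by contradiction
  qed
  then have "k \<in> {-1, 1}" "k' \<in> {-1, 1}"
    using ne kl root_labels_range by blast+
  have "?S \<subseteq> {\<delta>. \<delta> (cartan_elem 1 0 0) = 0}"
    by (rule real_vs.span_minimal) (auto simp: isotropic_eq real_vs.subspace_def real_scale_def)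
  moreover have "\<beta> \<in> aff.root_class \<beta>"
    unfolding aff.root_class_def using real_vs.span_zero by (intro CollectI exI[of _ 0]) simp
  then have "\<beta> \<in> aff.root_class (real_scale r \<alpha>)"
    using eq by simp
  then obtain \<delta> where "\<beta> = real_scale r \<alpha> + \<delta>" "\<delta> \<in> ?S"
    unfolding aff.root_class_def by blast
  ultimately have "\<beta> (cartan_elem 1 0 0) = of_real r * \<alpha> (cartan_elem 1 0 0)"
    by (auto simp: real_scale_def)
  then have "of_int k' = (of_real r * of_int k :: complex)"
    by (simp add: kl)
  then have "of_real (of_int k') = (of_real (r * of_int k) :: complex)"
    by simp
  then have "real_of_int k' = r * of_int k"
    by (simp only: of_real_eq_iff)
  with \<open>k \<in> {-1, 1}\<close> \<open>k' \<in> {-1, 1}\<close> show "r = 1 \<or> r = -1"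
    by auto
qed

section \<open>A character that does not extend to the root lattice\<close>

definition gap_char :: "((nat \<Rightarrow> complex) \<Rightarrow> complex) \<Rightarrow> complex" where
  "gap_char \<alpha> = (if \<exists>k l. \<alpha> = wt_fun k l \<and> card (odds l) \<le> 2 then 1 else -1)"

lemma gap_char_wt_fun: "gap_char (wt_fun k l) = (if card (odds l) \<le> 2 then 1 else -1)"
  by (auto simp: gap_char_def wt_fun_eq_iff)

lemma card_sym_diff_le: "card (sym_diff A B) \<le> card A + card (B :: 6 set)"
  by (rule order_trans[OF card_mono[of "A \<union> B"] card_Un_le]) auto

text \<open>
  The cosets in \<open>S\<close> have at most one odd coordinate or only odd ones, and the number of odd
  coordinates of a sum is governed by the symmetric difference.
\<close>
lemma root_labels_gap:
  assumes "(k, l) \<in> root_labels"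
  shows "card (odds l) \<le> 2 \<or> card (- odds l) \<le> 1"
proof -
  obtain p q where pq: "in_coset p q l"
    using assms by (auto simp: root_labels_def)
  then have l: "odds l = sym_diff (odds (deg p)) (odds (deg q))"
    by (rule odds_in_coset)
  have "card (odds (deg r)) \<le> 1 \<or> odds (deg r) = UNIV" for r
    by (cases r) (auto simp: odds_simps)
  from this[of p] this[of q] show ?thesis
    using card_sym_diff_le[of "odds (deg p)" "odds (deg q)"] by (auto simp: l)
qed

text \<open>
  The four estimates say that light and heavy degrees add like the elements 0 and 1 modulo 2; the
  gap excludes three and four odd coordinates.
\<close>
lemma gap_char_character: "is_character aff.roots gap_char"
  unfolding is_character_def
proof (intro conjI ballI impI)
  fix \<alpha> \<beta> assume "\<alpha> \<in> aff.roots" "\<beta> \<in> aff.roots" "\<alpha> + \<beta> \<in> aff.roots"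
  then obtain k l k' l' where ab: "\<alpha> = wt_fun k l" "\<beta> = wt_fun k' l'" "(k, l) \<in> root_labels"
    "(k', l') \<in> root_labels" "(k + k', l + l') \<in> root_labels"
    by (auto simp: roots_eq wt_fun_add wt_fun_eq_iff)
  have co: "card (- A) + card A = 6" for A :: "6 set"
    using card_Un_disjoint[of A "- A"] by simp
  have "odds l = sym_diff (odds (l + l')) (odds l')" "odds l' = sym_diff (odds (l + l')) (odds l)"
    "sym_diff (odds l) (odds l') = sym_diff (- odds l) (- odds l')"
    by (auto simp: odds_add)
  then have "card (odds l) \<le> card (odds (l + l')) + card (odds l')"
    "card (odds l') \<le> card (odds (l + l')) + card (odds l)"
    "card (odds (l + l')) \<le> card (- odds l) + card (- odds l')"
    "card (odds (l + l')) \<le> card (odds l) + card (odds l')"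
    by (metis card_sym_diff_le odds_add)+
  then have "card (odds (l + l')) \<le> 2 \<longleftrightarrow> (card (odds l) \<le> 2 \<longleftrightarrow> card (odds l') \<le> 2)"
    using ab(3-5)[THEN root_labels_gap] co[of "odds l"] co[of "odds l'"] co[of "odds (l + l')"]
      by linarith
  then show "gap_char (\<alpha> + \<beta>) = gap_char \<alpha> * gap_char \<beta>"
    by (simp add: ab gap_char_wt_fun wt_fun_add)
qed (simp add: gap_char_def)

lemma gap_char_not_extendable:
  "\<not> (\<exists>\<Psi>. is_root_lattice_character aff.roots \<Psi> \<and> (\<forall>\<alpha>\<in>aff.roots. \<Psi> \<alpha> = gap_char \<alpha>))"
proof clarify
  fix \<Psi> assume \<Psi>: "is_root_lattice_character aff.roots \<Psi>" and ext: "\<forall>\<alpha>\<in>aff.roots. \<Psi> \<alpha> = gap_char \<alpha>"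
  have mult: "\<Psi> (wt_fun 0 (l + m)) = \<Psi> (wt_fun 0 l) * \<Psi> (wt_fun 0 m)" for l m
  proof -
    have "wt_fun 0 l \<in> int_span aff.roots" "wt_fun 0 m \<in> int_span aff.roots"
      unfolding span_roots by blast+
    then have "\<Psi> (wt_fun 0 l + wt_fun 0 m) = \<Psi> (wt_fun 0 l) * \<Psi> (wt_fun 0 m)"
      using \<Psi> unfolding is_root_lattice_character_def by blast
    then show ?thesis by (simp add: wt_fun_add)
  qed
  have deg: "\<Psi> (wt_fun 0 (deg p)) = gap_char (wt_fun 0 (deg p))" for p
    using ext isotropic_deg_root by blast
  have gen: "\<Psi> (wt_fun 0 (axis i 1)) = 1" for i
    using deg[of "Gen i"] by (simp add: gap_char_wt_fun odds_def axis_def)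
  have "\<Psi> (wt_fun 0 (\<Sum>i\<in>A. axis i 1)) = 1" if "finite A" for A
    using that
  proof (induction A)
    case empty
    then show ?case using deg[of Zero] by (simp add: gap_char_wt_fun odds_def)
  next
    case (insert i A)
    then show ?case by (simp add: mult gen)
  qed
  moreover have "(\<Sum>i\<in>UNIV. axis i 1) = (1 :: lattice)"
    by (simp add: vec_eq_iff axis_def)
  ultimately have "\<Psi> (wt_fun 0 1) = 1"
    by (metis finite)
  moreover have "\<Psi> (wt_fun 0 1) = -1"
    using deg[of Total] by (simp add: gap_char_wt_fun odds_def)
  ultimately show False by simp
qed

theorem corollary5p2p2:
  "\<exists>(E :: (nat \<Rightarrow> complex) set) lie form H R \<Phi>.
     extended_affine_lie_algebra seq_scale E lie form H \<and>
     R = lie_algebra_form_cartan.roots seq_scale E lie H \<and>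
     lie_algebra_form_cartan.reduced seq_scale E lie form H \<and>
     is_character R \<Phi> \<and>
     \<not> (\<exists>\<Psi>. is_root_lattice_character R \<Psi> \<and> (\<forall>\<alpha>\<in>R. \<Psi> \<alpha> = \<Phi> \<alpha>))"
  using seq_E_extended_affine seq_E_reduced gap_char_character gap_char_not_extendable
  by blast

end
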